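(* The free projective plane $\pi^\omega$ is strongly type-homogeneous: for all finite tuples $\bar a,\bar b$ of elements of $\pi^\omega$ and every finite set $A\subseteq\pi^\omega$, $\bar a$ and $\bar b$ have the same type over $A$ in $\pi^\omega$ if and only if there is an automorphism $f$ of $\pi^\omega$ fixing $A$ pointwise with $f(\bar a)=\bar b$.
   Context: A partial plane is a system of points and lines such that two distinct points lie on at most one common line and two distinct lines meet in at most one common point. Free extension: given a partial plane $P$, let $P_0=P$; $P_{2k+1}$ is obtained from $P_{2k}$ by adding, for each pair of distinct points not joined by a line, a new line incident with exactly those two points; $P_{2k+2}$ is obtained from $P_{2k+1}$ by adding, for each pair of distinct lines with no common point, a new point incident with exactly those two lines; $F(P)=\bigcup_{n<\omega}P_n$. $\pi^\omega_0$ is the partial plane consisting of a line $\ell$, countably infinitely many points on $\ell$ and two points off $\ell$, and $\pi^\omega=F(\pi^\omega_0)$. Types are first-order types in the two-sorted language of points, lines and incidence. *)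

theory Defs
  imports Main "HOL-Library.Uprod"
begin

record ('p, 'l) incidence_structure =
  points :: "'p set"
  lines :: "'l set"
  incidence :: "('p \<times> 'l) set"

text \<open>The incidence clause for lines (two distinct lines meet in at most one point) is the
  contrapositive of the one for points; both are kept for readability.\<close>

definition partial_plane :: "('p, 'l) incidence_structure \<Rightarrow> bool" where
  "partial_plane M \<longleftrightarrow>
     incidence M \<subseteq> points M \<times> lines M \<and>
     (\<forall>p\<in>points M. \<forall>q\<in>points M. p \<noteq> q \<longrightarrow>
        (\<forall>l\<in>lines M. \<forall>m\<in>lines M.
           (p, l) \<in> incidence M \<and> (q, l) \<in> incidence M \<and>
           (p, m) \<in> incidence M \<and> (q, m) \<in> incidence M \<longrightarrow> l = m)) \<and>
     (\<forall>l\<in>lines M. \<forall>m\<in>lines M. l \<noteq> m \<longrightarrow>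
        (\<forall>p\<in>points M. \<forall>q\<in>points M.
           (p, l) \<in> incidence M \<and> (p, m) \<in> incidence M \<and>
           (q, l) \<in> incidence M \<and> (q, m) \<in> incidence M \<longrightarrow> p = q))"

definition elements :: "('p, 'l) incidence_structure \<Rightarrow> ('p + 'l) set" where
  "elements M = points M <+> lines M"

text \<open>Names for the points and lines of a free extension: those of the partial plane one starts
  from, the point added to meet an unordered pair of lines, and the line added to join an
  unordered pair of points.\<close>

datatype ('p, 'l) fpoint = OldPoint 'p | Meet "('p, 'l) fline uprod"
  and ('p, 'l) fline = OldLine 'l | Join "('p, 'l) fpoint uprod"

definition unjoined_pairs :: "('p, 'l) incidence_structure \<Rightarrow> 'p uprod set" where
  "unjoined_pairs M = {Upair p q | p q. p \<in> points M \<and> q \<in> points M \<and> p \<noteq> q \<and>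
     \<not> (\<exists>l\<in>lines M. (p, l) \<in> incidence M \<and> (q, l) \<in> incidence M)}"

definition unmet_pairs :: "('p, 'l) incidence_structure \<Rightarrow> 'l uprod set" where
  "unmet_pairs M = {Upair l m | l m. l \<in> lines M \<and> m \<in> lines M \<and> l \<noteq> m \<and>
     \<not> (\<exists>p\<in>points M. (p, l) \<in> incidence M \<and> (p, m) \<in> incidence M)}"

type_synonym ('p, 'l) free_structure =
  "(('p, 'l) fpoint, ('p, 'l) fline) incidence_structure"

definition old_part :: "('p, 'l) incidence_structure \<Rightarrow> ('p, 'l) free_structure" where
  "old_part P = \<lparr>points = OldPoint ` points P, lines = OldLine ` lines P,
     incidence = map_prod OldPoint OldLine ` incidence P\<rparr>"

definition add_joins :: "('p, 'l) free_structure \<Rightarrow> ('p, 'l) free_structure" where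
  "add_joins M = \<lparr>points = points M,
     lines = lines M \<union> Join ` unjoined_pairs M,
     incidence = incidence M \<union> {(p, Join u) | p u. u \<in> unjoined_pairs M \<and> p \<in> set_uprod u}\<rparr>"

definition add_meets :: "('p, 'l) free_structure \<Rightarrow> ('p, 'l) free_structure" where
  "add_meets M = \<lparr>points = points M \<union> Meet ` unmet_pairs M,
     lines = lines M,
     incidence = incidence M \<union> {(Meet u, l) | u l. u \<in> unmet_pairs M \<and> l \<in> set_uprod u}\<rparr>"

primrec free_stage :: "('p, 'l) incidence_structure \<Rightarrow> nat \<Rightarrow> ('p, 'l) free_structure" where
  "free_stage P 0 = old_part P"
| "free_stage P (Suc n) =
     (if even n then add_joins (free_stage P n) else add_meets (free_stage P n))"

definition free_extension :: "('p, 'l) incidence_structure \<Rightarrow> ('p, 'l) free_structure" where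
  "free_extension P = \<lparr>points = (\<Union>n. points (free_stage P n)),
     lines = (\<Union>n. lines (free_stage P n)),
     incidence = (\<Union>n. incidence (free_stage P n))\<rparr>"

text \<open>The next two lemmas, with their invariants, show that the elements added at a stage are
  indeed new: no \<^term>\<open>Join u\<close> or \<^term>\<open>Meet u\<close> that is being added is already present.\<close>

definition names_sound :: "('p, 'l) free_structure \<Rightarrow> bool" where
  "names_sound M \<longleftrightarrow>
     (\<forall>u. Join u \<in> lines M \<longrightarrow> (\<forall>p\<in>set_uprod u. (p, Join u) \<in> incidence M)) \<and>
     (\<forall>u. Meet u \<in> points M \<longrightarrow> (\<forall>l\<in>set_uprod u. (Meet u, l) \<in> incidence M))"

lemma names_sound_free_stage: "names_sound (free_stage P n)"
  by (induction n) (auto simp: names_sound_def old_part_def add_joins_def add_meets_def)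

lemma added_lines_new: "u \<in> unjoined_pairs (free_stage P n) \<Longrightarrow> Join u \<notin> lines (free_stage P n)"
  using names_sound_free_stage[of P n]
  by (fastforce simp: names_sound_def unjoined_pairs_def)

lemma added_points_new: "u \<in> unmet_pairs (free_stage P n) \<Longrightarrow> Meet u \<notin> points (free_stage P n)"
  using names_sound_free_stage[of P n]
  by (fastforce simp: names_sound_def unmet_pairs_def)

datatype base_point = On nat | Off1 | Off2

datatype base_line = Ell

definition pi_omega_0 :: "(base_point, base_line) incidence_structure" where
  "pi_omega_0 = \<lparr>points = UNIV, lines = {Ell}, incidence = {(On n, Ell) | n. True}\<rparr>"

lemma partial_plane_pi_omega_0: "partial_plane pi_omega_0"
  by (auto simp: partial_plane_def pi_omega_0_def)

definition pi_omega :: "(base_point, base_line) free_structure" where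
  "pi_omega = free_extension pi_omega_0"

text \<open>An automorphism of the two-sorted structure consists of a permutation of the points and a
  permutation of the lines; it acts on elements as \<^term>\<open>map_sum f g\<close>. The values of \<open>f\<close> and \<open>g\<close>
  outside the structure are irrelevant.\<close>

definition automorphism ::
  "('p, 'l) incidence_structure \<Rightarrow> ('p \<Rightarrow> 'p) \<Rightarrow> ('l \<Rightarrow> 'l) \<Rightarrow> bool" where
  "automorphism M f g \<longleftrightarrow>
     bij_betw f (points M) (points M) \<and> bij_betw g (lines M) (lines M) \<and>
     (\<forall>p\<in>points M. \<forall>l\<in>lines M. (f p, g l) \<in> incidence M \<longleftrightarrow> (p, l) \<in> incidence M)"

text \<open>The sort of a variable or parameter is determined by its position in the formula, so that
  the point variable and the line variable with the same index are different variables.\<close>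

datatype (params: 'e) tm = Var nat | Param 'e

datatype (point_params: 'p, line_params: 'l) fm =
    EqP "'p tm" "'p tm"
  | EqL "'l tm" "'l tm"
  | Inc "'p tm" "'l tm"
  | Neg "('p, 'l) fm"
  | Conj "('p, 'l) fm" "('p, 'l) fm"
  | ExP nat "('p, 'l) fm"
  | ExL nat "('p, 'l) fm"

primrec tm_vars :: "'e tm \<Rightarrow> nat set" where
  "tm_vars (Var i) = {i}"
| "tm_vars (Param e) = {}"

primrec free_point_vars :: "('p, 'l) fm \<Rightarrow> nat set" where
  "free_point_vars (EqP s t) = tm_vars s \<union> tm_vars t"
| "free_point_vars (EqL s t) = {}"
| "free_point_vars (Inc s t) = tm_vars s"
| "free_point_vars (Neg \<phi>) = free_point_vars \<phi>"
| "free_point_vars (Conj \<phi> \<psi>) = free_point_vars \<phi> \<union> free_point_vars \<psi>"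
| "free_point_vars (ExP i \<phi>) = free_point_vars \<phi> - {i}"
| "free_point_vars (ExL i \<phi>) = free_point_vars \<phi>"

primrec free_line_vars :: "('p, 'l) fm \<Rightarrow> nat set" where
  "free_line_vars (EqP s t) = {}"
| "free_line_vars (EqL s t) = tm_vars s \<union> tm_vars t"
| "free_line_vars (Inc s t) = tm_vars t"
| "free_line_vars (Neg \<phi>) = free_line_vars \<phi>"
| "free_line_vars (Conj \<phi> \<psi>) = free_line_vars \<phi> \<union> free_line_vars \<psi>"
| "free_line_vars (ExP i \<phi>) = free_line_vars \<phi>"
| "free_line_vars (ExL i \<phi>) = free_line_vars \<phi> - {i}"

primrec tm_val :: "(nat \<Rightarrow> 'e) \<Rightarrow> 'e tm \<Rightarrow> 'e" where
  "tm_val v (Var i) = v i"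
| "tm_val v (Param e) = e"

primrec sat ::
  "('p, 'l) incidence_structure \<Rightarrow> (nat \<Rightarrow> 'p) \<Rightarrow> (nat \<Rightarrow> 'l) \<Rightarrow> ('p, 'l) fm \<Rightarrow> bool" where
  "sat M v w (EqP s t) \<longleftrightarrow> tm_val v s = tm_val v t"
| "sat M v w (EqL s t) \<longleftrightarrow> tm_val w s = tm_val w t"
| "sat M v w (Inc s t) \<longleftrightarrow> (tm_val v s, tm_val w t) \<in> incidence M"
| "sat M v w (Neg \<phi>) \<longleftrightarrow> \<not> sat M v w \<phi>"
| "sat M v w (Conj \<phi> \<psi>) \<longleftrightarrow> sat M v w \<phi> \<and> sat M v w \<psi>"
| "sat M v w (ExP i \<phi>) \<longleftrightarrow> (\<exists>p\<in>points M. sat M (v(i := p)) w \<phi>)"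
| "sat M v w (ExL i \<phi>) \<longleftrightarrow> (\<exists>l\<in>lines M. sat M v (w(i := l)) \<phi>)"

text \<open>The type of a tuple \<open>a\<close> over \<open>A\<close>: the formulas with parameters in \<open>A\<close> that hold of \<open>a\<close>, the
  \<open>i\<close>-th entry of \<open>a\<close> being the value of the \<open>i\<close>-th variable of its own sort. Only these variables
  may be free, so the unspecified values of the assignments at all other variables play no role.
  Tuples of different lengths, or with differently sorted entries, have different types because
  \<open>x\<^sub>i = x\<^sub>i\<close> is in the type of \<open>a\<close> only if \<open>a\<close> has an \<open>i\<close>-th entry of the sort of \<open>x\<^sub>i\<close>.\<close>

definition type_over ::
  "('p, 'l) incidence_structure \<Rightarrow> ('p + 'l) set \<Rightarrow> ('p + 'l) list \<Rightarrow> ('p, 'l) fm set" where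
  "type_over M A a = {\<phi>.
     point_params \<phi> <+> line_params \<phi> \<subseteq> A \<and>
     free_point_vars \<phi> \<subseteq> {i. i < length a \<and> isl (a ! i)} \<and>
     free_line_vars \<phi> \<subseteq> {i. i < length a \<and> \<not> isl (a ! i)} \<and>
     sat M (\<lambda>i. projl (a ! i)) (\<lambda>i. projr (a ! i)) \<phi>}"

end

theory Submission
  imports Defs "HOL-Library.Countable_Set"
begin

text \<open>Call a set \<open>D\<close> of elements strong if every nonempty finite set \<open>E\<close> outside \<open>D\<close> has an element
  incident with at most two elements of \<open>D \<union> E\<close>. In \<open>\<pi>\<^sup>\<omega>\<close> every finite set lies in a finite strong
  set, and over every finite strong set there is a generic point. Hence a finite strong set can be
  enlarged one element at a time, each new element being incident with 0, 1 or 2 old ones, and each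
  such step can be copied over any isomorphic finite strong set; by back and forth, an isomorphism
  between finite strong sets extends to an automorphism.

  Let \<open>C\<close> be a smallest finite strong superset of \<open>S = a \<union> A\<close>. Minimality forces every element of
  \<open>C - S\<close> to be incident with at least three elements of \<open>C\<close>, and any finite set with this property
  lies in every strong superset of \<open>S\<close>. If \<open>b\<close> has the same type over \<open>A\<close> as \<open>a\<close>, then the diagram of
  \<open>C\<close> is realized over \<open>b\<close> and \<open>A\<close> by a set contained in the corresponding smallest strong set for
  \<open>b\<close>, and by symmetry and counting equal to it.\<close>

section \<open>The incidence graph, degrees and strong sets\<close>

section \<open>Strong subsets\<close>

text \<open>Points and lines become vertices of one symmetric graph. Joins and meets are then the
  same notion, a common neighbour, and most arguments serve both sorts at once.\<close>

definition adj :: "('p, 'l) incidence_structure \<Rightarrow> 'p + 'l \<Rightarrow> 'p + 'l \<Rightarrow> bool" where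
  "adj M x y \<longleftrightarrow>
     (\<exists>p l. (p, l) \<in> incidence M \<and> (x = Inl p \<and> y = Inr l \<or> x = Inr l \<and> y = Inl p))"

definition nbrs :: "('p, 'l) incidence_structure \<Rightarrow> 'p + 'l \<Rightarrow> ('p + 'l) set \<Rightarrow> ('p + 'l) set" where
  "nbrs M x S = {y \<in> S. adj M x y}"

definition strong :: "('p, 'l) incidence_structure \<Rightarrow> ('p + 'l) set \<Rightarrow> bool" where
  "strong M D \<longleftrightarrow> D \<subseteq> elements M \<and>
     (\<forall>E. E \<subseteq> elements M - D \<longrightarrow> finite E \<longrightarrow> E \<noteq> {} \<longrightarrow>
        (\<exists>e\<in>E. card (nbrs M e (D \<union> E)) \<le> 2))"

lemma adj_sym: "adj M x y \<Longrightarrow> adj M y x"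
  by (auto simp: adj_def)

lemma adj_commute: "adj M x y \<longleftrightarrow> adj M y x"
  by (auto simp: adj_def)

lemma adj_isl: "adj M x y \<Longrightarrow> isl x \<longleftrightarrow> \<not> isl y"
  by (auto simp: adj_def)

lemma adj_irrefl [simp]: "\<not> adj M x x"
  by (auto simp: adj_def)

lemma adj_Inl_Inr [simp]: "adj M (Inl p) (Inr l) \<longleftrightarrow> (p, l) \<in> incidence M"
  by (auto simp: adj_def)

lemma Inl_elements [simp]: "Inl p \<in> elements M \<longleftrightarrow> p \<in> points M"
  and Inr_elements [simp]: "Inr l \<in> elements M \<longleftrightarrow> l \<in> lines M"
  by (auto simp: elements_def)

lemma finite_nbrs [simp]: "finite S \<Longrightarrow> finite (nbrs M x S)"
  by (simp add: nbrs_def)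

lemma in_nbrs [simp]: "y \<in> nbrs M x S \<longleftrightarrow> y \<in> S \<and> adj M x y"
  by (simp add: nbrs_def)

lemma nbrs_mono: "S \<subseteq> T \<Longrightarrow> nbrs M x S \<subseteq> nbrs M x T"
  by (auto simp: nbrs_def)

lemma card_nbrs_mono: "S \<subseteq> T \<Longrightarrow> finite T \<Longrightarrow> card (nbrs M x S) \<le> card (nbrs M x T)"
  by (intro card_mono nbrs_mono finite_nbrs)

lemma strongD:
  assumes "strong M D" "E \<subseteq> elements M - D" "finite E" "E \<noteq> {}"
  shows "\<exists>e\<in>E. card (nbrs M e (D \<union> E)) \<le> 2"
  using assms unfolding strong_def by simp

lemma strong_subset: "strong M D \<Longrightarrow> D \<subseteq> elements M"
  by (simp add: strong_def)

text \<open>Only configurations inside \<open>D'\<close> need testing. If \<open>E\<close> sticks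
  out, strength of \<open>D'\<close> applies to \<open>E - D'\<close>, and the element found has no
  more neighbours in \<open>D \<union> E\<close> than in the larger set
  \<open>D' \<union> (E - D')\<close>.\<close>

lemma strong_sub:
  assumes "strong M D'" "finite D'" "D \<subseteq> D'"
    and *: "\<And>E. E \<subseteq> D' - D \<Longrightarrow> E \<noteq> {} \<Longrightarrow> \<exists>e\<in>E. card (nbrs M e (D \<union> E)) \<le> 2"
  shows "strong M D"
  unfolding strong_def
proof (intro conjI allI impI)
  show "D \<subseteq> elements M" using assms(1,3) strong_subset by blast
next
  fix E assume E: "E \<subseteq> elements M - D" "finite E" "E \<noteq> {}"
  show "\<exists>e\<in>E. card (nbrs M e (D \<union> E)) \<le> 2"
  proof (cases "E \<subseteq> D'")
    case True
    then show ?thesis using *[of E] E(1,3) by auto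
  next
    case False
    then have "\<exists>e\<in>E - D'. card (nbrs M e (D' \<union> (E - D'))) \<le> 2"
      by (intro strongD[OF assms(1)]) (use E in auto)
    then obtain e where e: "e \<in> E - D'" "card (nbrs M e (D' \<union> (E - D'))) \<le> 2" ..
    have "card (nbrs M e (D \<union> E)) \<le> card (nbrs M e (D' \<union> (E - D')))"
      by (rule card_nbrs_mono) (use assms E in auto)
    with e show ?thesis by (intro bexI[of _ e]) auto
  qed
qed

text \<open>Auxiliary elements of low degree can be forgotten again: by \<open>strong_sub\<close> no
  configuration other than \<open>{c}\<close> remains to be tested.\<close>

lemma strong_remove:
  assumes "strong M (insert c D)" "finite D" "card (nbrs M c D) \<le> 2"
  shows "strong M D"
proof (rule strong_sub[OF assms(1)])
  fix E assume "E \<subseteq> insert c D - D" "E \<noteq> {}"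
  then have "E = {c}" by auto
  moreover have "nbrs M c (D \<union> {c}) = nbrs M c D" by auto
  ultimately show "\<exists>e\<in>E. card (nbrs M e (D \<union> E)) \<le> 2" using assms(3) by simp
qed (use assms in auto)

lemma strong_degree:
  assumes "strong M D" "d \<in> elements M - D"
  shows "card (nbrs M d D) \<le> 2"
proof -
  have "nbrs M d (D \<union> {d}) = nbrs M d D" by auto
  then show ?thesis using strongD[OF assms(1), of "{d}"] assms(2) by fastforce
qed

text \<open>Two neighbours in \<open>D\<close> exhaust the degree of \<open>d\<close>. If
  \<open>E\<close> were a counterexample over \<open>insert d D\<close>, then in
  \<open>insert d E\<close> over \<open>D\<close> only \<open>d\<close> could have degree at most
  two, so \<open>d\<close> has no neighbour in \<open>E\<close>. Then \<open>d\<close> does not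
  affect degrees in \<open>E\<close>, and strength of \<open>D\<close> applied to \<open>E\<close>
  gives a contradiction.\<close>

lemma strong_insert:
  assumes "strong M D" "finite D" "d \<in> elements M - D" "2 \<le> card (nbrs M d D)"
  shows "strong M (insert d D)"
  unfolding strong_def
proof (intro conjI allI impI)
  show "insert d D \<subseteq> elements M" using assms strong_subset by blast
next
  fix E assume E: "E \<subseteq> elements M - insert d D" "finite E" "E \<noteq> {}"
  show "\<exists>e\<in>E. card (nbrs M e (insert d D \<union> E)) \<le> 2"
  proof (rule ccontr)
    assume neg: "\<not> ?thesis"
    have eq: "insert d D \<union> E = D \<union> insert d E" by auto
    have "\<exists>x\<in>insert d E. card (nbrs M x (D \<union> insert d E)) \<le> 2"
      by (intro strongD[OF assms(1)]) (use E assms(3) in auto)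
    then obtain x where x: "x \<in> insert d E" "card (nbrs M x (D \<union> insert d E)) \<le> 2" ..
    then have "x = d" using neg eq by auto
    with x(2) have le: "card (nbrs M d (D \<union> insert d E)) \<le> 2" by simp
    have "nbrs M d D = nbrs M d (D \<union> insert d E)"
      by (rule card_seteq) (use le assms E in \<open>auto intro: nbrs_mono\<close>)
    then have "e \<in> D" if "e \<in> E" "adj M d e" for e
      using that in_nbrs[of e M d D] by simp
    then have none: "\<not> adj M d e" if "e \<in> E" for e using that E by blast
    have "\<exists>e\<in>E. card (nbrs M e (D \<union> E)) \<le> 2"
      by (intro strongD[OF assms(1)]) (use E in auto)
    then obtain e where e: "e \<in> E" "card (nbrs M e (D \<union> E)) \<le> 2" ..
    have "nbrs M e (insert d D \<union> E) = nbrs M e (D \<union> E)"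
      using none[OF e(1)] by (auto simp: adj_commute[of M e d])
    then show False using neg e by auto
  qed
qed

text \<open>Strength bounds the degree by two, so two known neighbours are all of them.\<close>

lemma nbrs_eq_pair:
  assumes "strong M D" "finite D" "d \<in> elements M - D" "x \<in> D" "y \<in> D" "x \<noteq> y"
    "adj M d x" "adj M d y"
  shows "nbrs M d D = {x, y}"
proof -
  have "{x, y} = nbrs M d D"
    by (rule card_seteq) (use assms strong_degree[OF assms(1,3)] in auto)
  then show ?thesis ..
qed

section \<open>One-element strong extensions and the automorphisms built from them\<close>

section \<open>Back and forth\<close>

text \<open>Collects what back and forth uses, without mention of stages. Joins and meets are stated
  together through common neighbours. Generic points alone are required; generic lines are derived
  in \<open>generic_over_none\<close>.\<close>

locale generic_plane =
  fixes M :: "('p, 'l) incidence_structure"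
  assumes incidence_subset: "incidence M \<subseteq> points M \<times> lines M"
    and common_nbr: "\<lbrakk>x \<in> elements M; y \<in> elements M; x \<noteq> y; isl x \<longleftrightarrow> isl y\<rbrakk>
          \<Longrightarrow> \<exists>z. adj M x z \<and> adj M y z"
    and common_nbr_unique: "\<lbrakk>x \<noteq> y; adj M x z; adj M y z; adj M x w; adj M y w\<rbrakk> \<Longrightarrow> z = w"
    and countable_elements: "countable (elements M)"
    and finite_strong: "\<lbrakk>finite S; S \<subseteq> elements M\<rbrakk> \<Longrightarrow> \<exists>D. finite D \<and> S \<subseteq> D \<and> strong M D"
    and generic_point: "\<lbrakk>finite D; strong M D\<rbrakk>
          \<Longrightarrow> \<exists>x\<in>elements M - D. isl x \<and> nbrs M x D = {} \<and> strong M (insert x D)"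
begin

lemma adj_elements: "adj M x y \<Longrightarrow> x \<in> elements M \<and> y \<in> elements M"
  using incidence_subset by (auto simp: adj_def)

text \<open>The witness is the join or meet of \<open>y\<close> with the generic \<open>x\<close>.
  It has degree two over \<open>insert x D\<close>, so it can be added; afterwards \<open>x\<close>
  has no neighbour other than \<open>d\<close> and is forgotten by
  \<open>strong_remove\<close>.\<close>

lemma generic_over_one:
  assumes D: "finite D" "strong M D" and y: "y \<in> D"
    and x: "x \<in> elements M - D" "isl x \<longleftrightarrow> isl y" "nbrs M x D = {}" "strong M (insert x D)"
  shows "\<exists>d\<in>elements M - D. isl d \<noteq> isl y \<and> nbrs M d D = {y} \<and>
    strong M (insert d D)"
proof -
  have "x \<noteq> y" using x y by blast
  then obtain d where d: "adj M x d" "adj M y d"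
    using common_nbr[of x y] x(1,2) y strong_subset[OF D(2)] by blast
  have dV: "d \<in> elements M" using adj_elements[OF d(1)] by simp
  have "d \<notin> D" using d(1) x(3) in_nbrs[of d M x D] by auto
  then have dD: "d \<in> elements M - insert x D" using d dV by auto
  have nb: "nbrs M d (insert x D) = {x, y}"
    by (rule nbrs_eq_pair) (use x d dD D y \<open>x \<noteq> y\<close> adj_sym in auto)
  have "strong M (insert d (insert x D))"
    by (rule strong_insert) (use x D dD nb \<open>x \<noteq> y\<close> in auto)
  then have s: "strong M (insert x (insert d D))" by (simp add: insert_commute)
  have "nbrs M x (insert d D) \<subseteq> {d}" using x(3) by auto
  then have "card (nbrs M x (insert d D)) \<le> card {d}" by (intro card_mono) auto
  then have sd: "strong M (insert d D)"
    using strong_remove[OF s] D by simp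
  have "nbrs M d D = {y}" using nb x(1) y by (auto simp: set_eq_iff)
  then show ?thesis using dD sd adj_isl d adj_sym by blast
qed

text \<open>A generic line arises from two successive generic points \<open>x\<close> and
  \<open>y\<close>: over \<open>insert x D\<close>, the line that \<open>generic_over_one\<close>
  builds from \<open>y\<close> meets only \<open>x\<close>, and \<open>x\<close> can then be
  forgotten.\<close>

lemma generic_over_none:
  assumes D: "finite D" "strong M D"
  shows "\<exists>x\<in>elements M - D. isl x = s \<and> nbrs M x D = {} \<and> strong M (insert x D)"
proof (cases s)
  case True
  then show ?thesis using generic_point[OF D] by auto
next
  case False
  obtain x where x: "x \<in> elements M - D" "isl x" "nbrs M x D = {}" "strong M (insert x D)"
    using generic_point[OF D] by blast
  obtain y where y: "y \<in> elements M - insert x D" "isl y" "nbrs M y (insert x D) = {}"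
      "strong M (insert y (insert x D))"
    using generic_point[of "insert x D"] D x by auto
  obtain d where d: "d \<in> elements M - insert x D" "\<not> isl d" "nbrs M d (insert x D) = {x}"
      "strong M (insert d (insert x D))"
    using generic_over_one[of "insert x D" x y] D x y by auto
  have "nbrs M x (insert d D) \<subseteq> {d}" using x(3) by auto
  then have "card (nbrs M x (insert d D)) \<le> card {d}" by (intro card_mono) auto
  then have "strong M (insert d D)"
    using strong_remove[of M x "insert d D"] d D by (simp add: insert_commute)
  moreover have "nbrs M d D = {}" using d x by (auto simp: set_eq_iff)
  ultimately show ?thesis using d False by blast
qed

text \<open>Every neighbourhood that \<open>strong_degree\<close> permits is realized. No or one
  prescribed neighbour calls for a generic element, two for their join or meet, which
  \<open>new\<close> places outside \<open>D\<close>.\<close>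

lemma strong_extension:
  assumes D: "finite D" "strong M D" and Y: "Y \<subseteq> D" "\<forall>y\<in>Y. isl y \<noteq> s" "card Y \<le> 2"
    and new: "card Y = 2 \<Longrightarrow> \<not> (\<exists>d\<in>D. Y \<subseteq> nbrs M d D)"
  shows "\<exists>d\<in>elements M - D. isl d = s \<and> nbrs M d D = Y \<and> strong M (insert d D)"
proof -
  have fY: "finite Y" using D Y finite_subset by blast
  consider "card Y = 0" | "card Y = 1" | "card Y = 2" using Y(3) by linarith
  then show ?thesis
  proof cases
    case 1
    then show ?thesis using generic_over_none[OF D] fY by auto
  next
    case 2
    then obtain y where y: "Y = {y}" by (auto simp: card_1_singleton_iff)
    obtain x where x: "x \<in> elements M - D" "isl x = isl y" "nbrs M x D = {}" "strong M (insert x D)"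
      using generic_over_none[OF D] by blast
    show ?thesis using generic_over_one[OF D _ x] y Y by auto
  next
    case 3
    then obtain x y where xy: "Y = {x, y}" "x \<noteq> y" by (auto simp: card_2_iff)
    then obtain d where d: "adj M x d" "adj M y d"
      using common_nbr[of x y] Y strong_subset[OF D(2)] by blast
    then have dD: "d \<in> elements M - D"
      using new[OF 3] Y(1) xy adj_elements adj_sym by fastforce
    have nb: "nbrs M d D = {x, y}"
      by (rule nbrs_eq_pair) (use D dD xy Y d adj_sym in auto)
    then have "strong M (insert d D)"
      by (intro strong_insert) (use D dD xy in auto)
    then show ?thesis using nb xy dD d Y adj_isl by blast
  qed
qed

text \<open>A relation rather than a function, so that \<open>piso_converse\<close> turns forth
  steps into back steps. The clause \<open>x = x' \<longleftrightarrow> y = y'\<close> makes it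
  single-valued and injective at once.\<close>

definition piso :: "(('p + 'l) \<times> ('p + 'l)) set \<Rightarrow> bool" where
  "piso R \<longleftrightarrow> finite R \<and> strong M (Domain R) \<and> strong M (Range R) \<and>
     (\<forall>x y. (x, y) \<in> R \<longrightarrow> isl x = isl y) \<and>
     (\<forall>x y x' y'. (x, y) \<in> R \<longrightarrow> (x', y') \<in> R \<longrightarrow>
        (x = x' \<longleftrightarrow> y = y') \<and> (adj M x x' \<longleftrightarrow> adj M y y'))"

lemma piso_converse: "piso R \<Longrightarrow> piso (R\<inverse>)"
  unfolding piso_def by auto

lemma piso_step:
  assumes R: "piso R" and c: "c \<in> elements M - Domain R" and s: "strong M (insert c (Domain R))"
  shows "\<exists>d. piso (insert (c, d) R)"
proof -
  have fin: "finite R" "finite (Domain R)" "finite (Range R)"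
    using R by (auto simp: piso_def finite_Domain finite_Range)
  have sD: "strong M (Domain R)" and sR: "strong M (Range R)"
    and srt: "\<And>x y. (x, y) \<in> R \<Longrightarrow> isl x = isl y"
    and eq: "\<And>x y x' y'. (x, y) \<in> R \<Longrightarrow> (x', y') \<in> R \<Longrightarrow> x = x' \<longleftrightarrow> y = y'"
    and ad: "\<And>x y x' y'. (x, y) \<in> R \<Longrightarrow> (x', y') \<in> R \<Longrightarrow> adj M x x' \<longleftrightarrow> adj M y y'"
    using R by (auto simp: piso_def)
  define N where "N = nbrs M c (Domain R)"
  define Y where "Y = R `` N"
  have finN: "finite N" and N2: "card N \<le> 2"
    using fin strong_degree[OF sD c] by (auto simp: N_def)
  have "\<forall>x\<in>N. \<exists>y. (x, y) \<in> R" by (auto simp: N_def)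
  then obtain h where h: "\<And>x. x \<in> N \<Longrightarrow> (x, h x) \<in> R" by metis
  have Yh: "Y = h ` N" using h eq by (fastforce simp: Y_def)
  then have cY: "card Y \<le> card N" using finN card_image_le by blast
  have "\<exists>d\<in>elements M - Range R. isl d = isl c \<and> nbrs M d (Range R) = Y \<and> strong M (insert d (Range R))"
  proof (rule strong_extension[OF fin(3) sR])
    show "Y \<subseteq> Range R" by (auto simp: Y_def)
    show "\<forall>y\<in>Y. isl y \<noteq> isl c"
      using srt adj_isl by (fastforce simp: Y_def N_def)
    show "card Y \<le> 2" using cY N2 by simp
  next
    assume "card Y = 2"
    then obtain x y where xy: "x \<in> N" "y \<in> N" "x \<noteq> y"
      using cY N2 by (metis card_2_iff le_antisym insertCI)
    \<comment> \<open>A common neighbour \<open>d\<close> of the two images would pull back to a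
      common neighbour \<open>c'\<close> of \<open>x\<close> and \<open>y\<close> in the domain.
      Common neighbours are unique, so \<open>c' = c\<close>, but \<open>c\<close> is not in the
      domain.\<close>
    show "\<not> (\<exists>d\<in>Range R. Y \<subseteq> nbrs M d (Range R))"
    proof
      assume "\<exists>d\<in>Range R. Y \<subseteq> nbrs M d (Range R)"
      then obtain c' d where cd: "(c', d) \<in> R" "Y \<subseteq> nbrs M d (Range R)" by blast
      have "adj M x c'" "adj M y c'"
        using cd h[OF xy(1)] h[OF xy(2)] ad xy by (auto simp: Yh adj_commute)
      moreover have "adj M x c" "adj M y c" using xy by (auto simp: N_def adj_commute)
      ultimately have "c' = c" using common_nbr_unique xy(3) by blast
      then show False using cd c by blast
    qed
  qed
  then obtain d where d: "d \<in> elements M - Range R" "isl d = isl c" "nbrs M d (Range R) = Y"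
      "strong M (insert d (Range R))" by blast
  have adc: "adj M c x \<longleftrightarrow> adj M d y" if "(x, y) \<in> R" for x y
  proof
    assume "adj M c x"
    then have "x \<in> N" using that by (auto simp: N_def)
    then have "y \<in> Y" using that by (auto simp: Y_def)
    then show "adj M d y" using d(3) by auto
  next
    assume "adj M d y"
    then have "y \<in> Y" using d(3) that by auto
    then obtain x' where "x' \<in> N" "(x', y) \<in> R" by (auto simp: Y_def)
    then show "adj M c x" using eq that by (auto simp: N_def)
  qed
  have "x \<noteq> c" "y \<noteq> d" if "(x, y) \<in> R" for x y using that c d by auto
  then have "piso (insert (c, d) R)"
    unfolding piso_def using fin s d srt eq ad adc
    by (auto simp: adj_commute[of M _ c] adj_commute[of M _ d])
  then show ?thesis ..
qed

text \<open>Induction on the number of missing elements. Strength of the domain provides a missing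
  \<open>e\<close> of degree at most two in \<open>C\<close>, so \<open>C - {e}\<close> is still
  strong; the map is extended to \<open>C - {e}\<close> first and to \<open>e\<close> last, by
  \<open>piso_step\<close>.\<close>

lemma piso_extend_to:
  assumes "piso R" "finite C" "strong M C" "Domain R \<subseteq> C"
  shows "\<exists>R'. R \<subseteq> R' \<and> piso R' \<and> Domain R' = C"
  using assms
proof (induction "card (C - Domain R)" arbitrary: C)
  case 0
  then have "Domain R = C" by auto
  then show ?case using 0 by blast
next
  case (Suc n)
  define E where "E = C - Domain R"
  have "E \<noteq> {}" using Suc.hyps(2) unfolding E_def by (metis card.empty nat.distinct(1))
  moreover have "E \<subseteq> elements M - Domain R" using strong_subset[OF Suc.prems(3)] by (auto simp: E_def)
  moreover have "finite E" using Suc.prems by (simp add: E_def)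
  moreover have "strong M (Domain R)" using Suc.prems by (simp add: piso_def)
  ultimately obtain e where e: "e \<in> E" "card (nbrs M e (Domain R \<union> E)) \<le> 2"
    using strongD by metis
  have C: "Domain R \<union> E = C" using Suc.prems by (auto simp: E_def)
  have ins: "insert e (C - {e}) = C" using e by (auto simp: E_def)
  have "strong M (C - {e})"
  proof (rule strong_remove)
    show "strong M (insert e (C - {e}))" using ins Suc.prems by simp
    have "card (nbrs M e (C - {e})) \<le> card (nbrs M e C)"
      by (rule card_nbrs_mono) (use Suc.prems in auto)
    then show "card (nbrs M e (C - {e})) \<le> 2" using e C by simp
  qed (use Suc.prems in simp)
  moreover have "n = card (C - {e} - Domain R)"
  proof -
    have "C - {e} - Domain R = E - {e}" by (auto simp: E_def)
    then show ?thesis using Suc.hyps(2) e \<open>finite E\<close> by (simp add: E_def)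
  qed
  ultimately obtain R' where R': "R \<subseteq> R'" "piso R'" "Domain R' = C - {e}"
    using Suc.hyps(1)[of "C - {e}"] Suc.prems e by (auto simp: E_def)
  have "\<exists>d. piso (insert (e, d) R')"
    by (rule piso_step) (use R' ins Suc.prems e strong_subset[OF Suc.prems(3)] in \<open>auto simp: E_def\<close>)
  then obtain d where "piso (insert (e, d) R')" ..
  moreover have "Domain (insert (e, d) R') = C" using R' ins by simp
  ultimately show ?case using R'(1) by (intro exI[of _ "insert (e, d) R'"]) auto
qed

lemma piso_forth:
  assumes "piso R" "x \<in> elements M"
  shows "\<exists>R'. R \<subseteq> R' \<and> piso R' \<and> x \<in> Domain R'"
proof -
  have "finite (insert x (Domain R))" "insert x (Domain R) \<subseteq> elements M"
    using assms by (auto simp: piso_def finite_Domain dest: strong_subset)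
  then obtain C where "finite C" "insert x (Domain R) \<subseteq> C" "strong M C"
    using finite_strong by blast
  then show ?thesis using piso_extend_to[OF assms(1), of C] by auto
qed

lemma piso_back:
  assumes "piso R" "x \<in> elements M"
  shows "\<exists>R'. R \<subseteq> R' \<and> piso R' \<and> x \<in> Range R'"
proof -
  obtain R' where "R\<inverse> \<subseteq> R'" "piso R'" "x \<in> Domain R'"
    using piso_forth[OF piso_converse[OF assms(1)] assms(2)] by blast
  then show ?thesis using piso_converse[of R'] by (intro exI[of _ "R'\<inverse>"]) auto
qed

text \<open>Back and forth along an enumeration: the union of a chain of extensions that captures
  every element in both domain and range is the graph of an automorphism.\<close>

lemma piso_automorphism:
  assumes "piso R"
  shows "\<exists>f g. automorphism M f g \<and> (\<forall>(x, y)\<in>R. map_sum f g x = y)"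
proof -
  \<comment> \<open>The enumeration may take the value \<open>undefined\<close> outside
    \<open>elements M\<close>; the guard \<open>e n \<in> elements M\<close> in the chain below
    skips it.\<close>
  define e where "e = from_nat_into (insert undefined (elements M))"
  have cnt: "countable (insert undefined (elements M))" using countable_elements by simp
  have "\<exists>h. \<forall>n. (piso (h n) \<and> (n = 0 \<longrightarrow> h n = R)) \<and>
      (h n \<subseteq> h (Suc n) \<and> (e n \<in> elements M \<longrightarrow> e n \<in> Domain (h (Suc n)) \<and> e n \<in> Range (h (Suc n))))"
  proof (rule dependent_nat_choice)
    show "\<exists>Q. piso Q \<and> (0 = (0::nat) \<longrightarrow> Q = R)" using assms by simp
  next
    fix Q and n :: nat assume "piso Q \<and> (n = 0 \<longrightarrow> Q = R)"
    then have Q: "piso Q" by simp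
    show "\<exists>Q'. (piso Q' \<and> (Suc n = 0 \<longrightarrow> Q' = R)) \<and>
        Q \<subseteq> Q' \<and> (e n \<in> elements M \<longrightarrow> e n \<in> Domain Q' \<and> e n \<in> Range Q')"
    proof (cases "e n \<in> elements M")
      case True
      obtain Q1 where Q1: "Q \<subseteq> Q1" "piso Q1" "e n \<in> Domain Q1" using piso_forth[OF Q True] by blast
      obtain Q2 where "Q1 \<subseteq> Q2" "piso Q2" "e n \<in> Range Q2" using piso_back[OF Q1(2) True] by blast
      then show ?thesis using Q1 by (intro exI[of _ Q2]) auto
    next
      case False
      then show ?thesis using Q by (intro exI[of _ Q]) auto
    qed
  qed
  then obtain h where h0: "h 0 = R" and hp: "\<And>n. piso (h n)" and hS: "\<And>n. h n \<subseteq> h (Suc n)"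
    and he: "\<And>n. e n \<in> elements M \<Longrightarrow> e n \<in> Domain (h (Suc n)) \<and> e n \<in> Range (h (Suc n))"
    by blast
  define H where "H = (\<Union>n. h n)"
  have mono: "h m \<subseteq> h n" if "m \<le> n" for m n using lift_Suc_mono_le[of h, OF hS that] .
  \<comment> \<open>The sort, equality and incidence clauses of \<open>piso\<close> involve at most
    two pairs, which lie in one member of the chain, so they pass to the union.\<close>
  have two: "\<exists>n. q \<in> h n \<and> r \<in> h n" if qr: "q \<in> H" "r \<in> H" for q r
  proof -
    obtain m n where "q \<in> h m" "r \<in> h n" using qr by (auto simp: H_def)
    then show ?thesis using mono[of m "max m n"] mono[of n "max m n"] by (intro exI[of _ "max m n"]) auto
  qed
  have srt: "isl x = isl y" if "(x, y) \<in> H" for x y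
    using that hp unfolding H_def piso_def by blast
  have inj: "x = x' \<longleftrightarrow> y = y'" and ad: "adj M x x' \<longleftrightarrow> adj M y y'"
    if "(x, y) \<in> H" "(x', y') \<in> H" for x y x' y'
    using two[OF that] hp unfolding piso_def by blast+
  have sub: "x \<in> elements M \<and> y \<in> elements M" if xy: "(x, y) \<in> H" for x y
  proof -
    obtain n where n: "(x, y) \<in> h n" using xy by (auto simp: H_def)
    have "Domain (h n) \<subseteq> elements M" "Range (h n) \<subseteq> elements M"
      using hp[of n] strong_subset unfolding piso_def by blast+
    then show ?thesis using n by blast
  qed
  have ran: "\<exists>n. e n = x" if "x \<in> elements M" for x
    using from_nat_into_surj[OF cnt, of x] that by (auto simp: e_def)
  have tot: "\<exists>y. (x, y) \<in> H" and sur: "\<exists>y. (y, x) \<in> H" if "x \<in> elements M" for x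
    using ran[OF that] that he unfolding H_def by blast+
  define k where "k x = (SOME y. (x, y) \<in> H)" for x
  have k: "(x, k x) \<in> H" if "x \<in> elements M" for x
    unfolding k_def using tot[OF that] by (rule someI_ex)
  have k_eq: "k x = y" if "(x, y) \<in> H" for x y
    using inj[OF that k] sub[OF that] by blast
  define f where "f p = projl (k (Inl p))" for p
  define g where "g l = projr (k (Inr l))" for l
  have kl: "k (Inl p) = Inl (f p)" if "p \<in> points M" for p
    using srt[OF k, of "Inl p"] that by (cases "k (Inl p)") (auto simp: f_def)
  have kr: "k (Inr l) = Inr (g l)" if "l \<in> lines M" for l
    using srt[OF k, of "Inr l"] that by (cases "k (Inr l)") (auto simp: g_def)
  have kmap: "map_sum f g x = k x" if "x \<in> elements M" for x
    using that kl kr by (cases x) auto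
  have f: "bij_betw f (points M) (points M)"
    unfolding bij_betw_def
  proof
    show "inj_on f (points M)"
    proof (rule inj_onI)
      fix p q assume "p \<in> points M" "q \<in> points M" "f p = f q"
      then show "p = q" using inj[OF k[of "Inl p"] k[of "Inl q"]] by (simp add: kl)
    qed
    have "f p \<in> points M" if "p \<in> points M" for p
      using sub[OF k[of "Inl p"]] that by (simp add: kl)
    moreover have "p \<in> f ` points M" if "p \<in> points M" for p
    proof -
      obtain y where y: "(y, Inl p) \<in> H" using sur[of "Inl p"] \<open>p \<in> points M\<close> by auto
      then obtain q where "y = Inl q" using srt[OF y] by (cases y) auto
      then show ?thesis using y k_eq[OF y] sub[OF y] kl[of q] by auto
    qed
    ultimately show "f ` points M = points M" by blast
  qed
  have g: "bij_betw g (lines M) (lines M)"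
    unfolding bij_betw_def
  proof
    show "inj_on g (lines M)"
    proof (rule inj_onI)
      fix p q assume "p \<in> lines M" "q \<in> lines M" "g p = g q"
      then show "p = q" using inj[OF k[of "Inr p"] k[of "Inr q"]] by (simp add: kr)
    qed
    have "g p \<in> lines M" if "p \<in> lines M" for p
      using sub[OF k[of "Inr p"]] that by (simp add: kr)
    moreover have "p \<in> g ` lines M" if "p \<in> lines M" for p
    proof -
      obtain y where y: "(y, Inr p) \<in> H" using sur[of "Inr p"] \<open>p \<in> lines M\<close> by auto
      then obtain q where "y = Inr q" using srt[OF y] by (cases y) auto
      then show ?thesis using y k_eq[OF y] sub[OF y] kr[of q] by auto
    qed
    ultimately show "g ` lines M = lines M" by blast
  qed
  have "(f p, g l) \<in> incidence M \<longleftrightarrow> (p, l) \<in> incidence M" if "p \<in> points M" "l \<in> lines M" for p l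
    using ad[OF k[of "Inl p"] k[of "Inr l"]] that by (simp add: kl kr)
  then have "automorphism M f g" using f g by (simp add: automorphism_def)
  moreover have "map_sum f g x = y" if "(x, y) \<in> R" for x y
  proof -
    have "(x, y) \<in> H" using that h0 by (auto simp: H_def)
    then show ?thesis using k_eq kmap sub by metis
  qed
  ultimately show ?thesis by blast
qed

end

section \<open>Formulas evaluated on tuples, and finite diagrams\<close>

section \<open>Types\<close>

text \<open>The three conditions in \<open>type_over\<close> are separated, so that a formula can be
  evaluated at tuples other than the one it was made for. \<open>fits\<close> depends only on the
  length and the sorts of the tuple.\<close>

definition fits :: "('p, 'l) fm \<Rightarrow> ('p + 'l) list \<Rightarrow> bool" where
  "fits \<phi> s \<longleftrightarrow> free_point_vars \<phi> \<subseteq> {i. i < length s \<and> isl (s ! i)} \<and>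
     free_line_vars \<phi> \<subseteq> {i. i < length s \<and> \<not> isl (s ! i)}"

definition over :: "('p + 'l) set \<Rightarrow> ('p, 'l) fm \<Rightarrow> bool" where
  "over A \<phi> \<longleftrightarrow> point_params \<phi> <+> line_params \<phi> \<subseteq> A"

definition holds :: "('p, 'l) incidence_structure \<Rightarrow> ('p + 'l) list \<Rightarrow> ('p, 'l) fm \<Rightarrow> bool" where
  "holds M s \<phi> \<longleftrightarrow> sat M (\<lambda>i. projl (s ! i)) (\<lambda>i. projr (s ! i)) \<phi>"

lemma type_over_alt: "type_over M A a = {\<phi>. over A \<phi> \<and> fits \<phi> a \<and> holds M a \<phi>}"
  by (auto simp: type_over_def over_def fits_def holds_def)

lemma tm_val_cong: "(\<And>i. i \<in> tm_vars t \<Longrightarrow> v i = v' i) \<Longrightarrow> tm_val v t = tm_val v' t"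
  by (cases t) auto

lemma sat_cong:
  assumes "\<And>i. i \<in> free_point_vars \<phi> \<Longrightarrow> v i = v' i" "\<And>i. i \<in> free_line_vars \<phi> \<Longrightarrow> w i = w' i"
  shows "sat M v w \<phi> \<longleftrightarrow> sat M v' w' \<phi>"
  using assms
proof (induction \<phi> arbitrary: v v' w w')
  case (EqP s t)
  then have "tm_val v s = tm_val v' s" "tm_val v t = tm_val v' t" by (auto intro!: tm_val_cong)
  then show ?case by simp
next
  case (EqL s t)
  then have "tm_val w s = tm_val w' s" "tm_val w t = tm_val w' t" by (auto intro!: tm_val_cong)
  then show ?case by simp
next
  case (Inc s t)
  then have "tm_val v s = tm_val v' s" "tm_val w t = tm_val w' t" by (auto intro!: tm_val_cong)
  then show ?case by simp
next
  case (Neg \<phi>)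
  have "sat M v w \<phi> \<longleftrightarrow> sat M v' w' \<phi>" by (rule Neg.IH) (use Neg.prems in auto)
  then show ?case by simp
next
  case (Conj \<phi> \<psi>)
  have "sat M v w \<phi> \<longleftrightarrow> sat M v' w' \<phi>" "sat M v w \<psi> \<longleftrightarrow> sat M v' w' \<psi>"
    by (rule Conj.IH; use Conj.prems in auto)+
  then show ?case by simp
next
  case (ExP i \<phi>)
  have "sat M (v(i := p)) w \<phi> \<longleftrightarrow> sat M (v'(i := p)) w' \<phi>" for p
    by (rule ExP.IH) (use ExP.prems in auto)
  then show ?case by simp
next
  case (ExL i \<phi>)
  have "sat M v (w(i := l)) \<phi> \<longleftrightarrow> sat M v' (w'(i := l)) \<phi>" for l
    by (rule ExL.IH) (use ExL.prems in auto)
  then show ?case by simp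
qed

lemma map_isl_eqD: "map isl t = map isl s \<Longrightarrow> i < length s \<Longrightarrow> isl (t ! i) = isl (s ! i)"
  by (metis length_map nth_map)

lemma bex_points: "(\<exists>y\<in>elements M. isl y \<and> Q y) \<longleftrightarrow> (\<exists>p\<in>points M. Q (Inl p))"
  by (metis Inl_elements sum.collapse(1) sum.disc(1))

lemma bex_lines: "(\<exists>y\<in>elements M. \<not> isl y \<and> Q y) \<longleftrightarrow> (\<exists>l\<in>lines M. Q (Inr l))"
  by (metis Inr_elements sum.collapse(2) sum.disc(2))

text \<open>The quantified variable is the one with index \<open>length a\<close>, the position of
  \<open>x\<close> in \<open>a @ [x]\<close>; the sort of \<open>x\<close> decides between
  \<open>ExP\<close> and \<open>ExL\<close>. One formula serves all \<open>b\<close> with the sorts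
  of \<open>a\<close>.\<close>

lemma exists_last:
  assumes "fits \<phi> (a @ [x])" "over A \<phi>"
  shows "\<exists>\<psi>. fits \<psi> a \<and> over A \<psi> \<and> (\<forall>b. map isl b = map isl a \<longrightarrow>
    (holds M b \<psi> \<longleftrightarrow> (\<exists>y\<in>elements M. isl y = isl x \<and> holds M (b @ [y]) \<phi>)))"
proof (cases x)
  case (Inl p)
  have fv: "i < length a \<and> isl (a ! i) \<or> i = length a" if "i \<in> free_point_vars \<phi>" for i
    using assms(1) that by (auto simp: fits_def nth_append split: if_splits)
  have fl: "i < length a \<and> \<not> isl (a ! i)" if "i \<in> free_line_vars \<phi>" for i
    using assms(1) that Inl by (fastforce simp: fits_def nth_append split: if_splits)
  have "holds M b (ExP (length a) \<phi>) \<longleftrightarrow> (\<exists>y\<in>elements M. isl y = isl x \<and> holds M (b @ [y]) \<phi>)"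
    if b: "map isl b = map isl a" for b
  proof -
    have len: "length b = length a" using b map_eq_imp_length_eq by blast
    have "sat M ((\<lambda>i. projl (b ! i))(length a := q)) (\<lambda>i. projr (b ! i)) \<phi> \<longleftrightarrow>
        holds M (b @ [Inl q]) \<phi>" for q
      unfolding holds_def by (rule sat_cong) (use fv fl len in \<open>fastforce simp: nth_append\<close>)+
    then show ?thesis
      unfolding holds_def[of M b] using Inl by (simp add: bex_points)
  qed
  moreover have "fits (ExP (length a) \<phi>) a" using fv fl by (auto simp: fits_def)
  moreover have "over A (ExP (length a) \<phi>)" using assms(2) by (simp add: over_def)
  ultimately show ?thesis by blast
next
  case (Inr l)
  have fv: "i < length a \<and> \<not> isl (a ! i) \<or> i = length a" if "i \<in> free_line_vars \<phi>" for i
    using assms(1) that by (auto simp: fits_def nth_append split: if_splits)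
  have fl: "i < length a \<and> isl (a ! i)" if "i \<in> free_point_vars \<phi>" for i
    using assms(1) that Inr by (fastforce simp: fits_def nth_append split: if_splits)
  have "holds M b (ExL (length a) \<phi>) \<longleftrightarrow> (\<exists>y\<in>elements M. isl y = isl x \<and> holds M (b @ [y]) \<phi>)"
    if b: "map isl b = map isl a" for b
  proof -
    have len: "length b = length a" using b map_eq_imp_length_eq by blast
    have "sat M (\<lambda>i. projl (b ! i)) ((\<lambda>i. projr (b ! i))(length a := q)) \<phi> \<longleftrightarrow>
        holds M (b @ [Inr q]) \<phi>" for q
      unfolding holds_def by (rule sat_cong) (use fv fl len in \<open>fastforce simp: nth_append\<close>)+
    then show ?thesis
      unfolding holds_def[of M b] using Inr by (simp add: bex_lines)
  qed
  moreover have "fits (ExL (length a) \<phi>) a" using fv fl by (auto simp: fits_def)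
  moreover have "over A (ExL (length a) \<phi>)" using assms(2) by (simp add: over_def)
  ultimately show ?thesis by blast
qed

text \<open>Entries of \<open>c\<close> are quantified out from the right, so that
  \<open>exists_last\<close> always meets the last entry of the remaining tuple.\<close>

lemma exists_tuple:
  assumes "fits \<phi> (a @ c)" "over A \<phi>" "holds M (a @ c) \<phi>" "set c \<subseteq> elements M"
  shows "\<exists>\<psi>. fits \<psi> a \<and> over A \<psi> \<and> holds M a \<psi> \<and> (\<forall>b. map isl b = map isl a \<longrightarrow> holds M b \<psi> \<longrightarrow>
    (\<exists>d. set d \<subseteq> elements M \<and> map isl d = map isl c \<and> holds M (b @ d) \<phi>))"
  using assms
proof (induction c arbitrary: a)
  case Nil
  then show ?case by (intro exI[of _ \<phi>]) auto
next
  case (Cons x c)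
  obtain \<chi> where \<chi>: "fits \<chi> (a @ [x])" "over A \<chi>" "holds M (a @ [x]) \<chi>"
    "\<And>b. map isl b = map isl (a @ [x]) \<Longrightarrow> holds M b \<chi> \<Longrightarrow>
      \<exists>d. set d \<subseteq> elements M \<and> map isl d = map isl c \<and> holds M (b @ d) \<phi>"
    using Cons.IH[of "a @ [x]"] Cons.prems by auto
  obtain \<psi> where \<psi>: "fits \<psi> a" "over A \<psi>" and h: "\<And>b. map isl b = map isl a \<Longrightarrow>
      holds M b \<psi> \<longleftrightarrow> (\<exists>y\<in>elements M. isl y = isl x \<and> holds M (b @ [y]) \<chi>)"
    using exists_last[OF \<chi>(1,2)] by blast
  have "holds M a \<psi>" using h[of a] \<chi>(3) Cons.prems(4) by auto
  moreover have "\<exists>d. set d \<subseteq> elements M \<and> map isl d = map isl (x # c) \<and> holds M (b @ d) \<phi>"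
    if b: "map isl b = map isl a" "holds M b \<psi>" for b
  proof -
    obtain y where y: "y \<in> elements M" "isl y = isl x" "holds M (b @ [y]) \<chi>" using h b by blast
    then obtain d where "set d \<subseteq> elements M" "map isl d = map isl c" "holds M ((b @ [y]) @ d) \<phi>"
      using \<chi>(4)[of "b @ [y]"] b by auto
    then show ?thesis using y by (intro exI[of _ "y # d"]) auto
  qed
  ultimately show ?case using \<psi> by blast
qed

lemma finite_conjunction:
  assumes "finite \<Phi>" "\<forall>\<phi>\<in>\<Phi>. fits \<phi> s \<and> over A \<phi>"
  shows "\<exists>\<psi>. fits \<psi> s \<and> over A \<psi> \<and> (\<forall>t. holds M t \<psi> \<longleftrightarrow> (\<forall>\<phi>\<in>\<Phi>. holds M t \<phi>))"
  using assms
proof (induction rule: finite_induct)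
  case empty
  \<comment> \<open>The empty conjunction must be a true closed formula: an open one such as
    \<open>EqP (Var 0) (Var 0)\<close> need not fit \<open>s\<close>.\<close>
  have "fits (Neg (ExP 0 (Neg (EqP (Var 0) (Var 0))))) s" by (auto simp: fits_def)
  then show ?case
    by (intro exI[of _ "Neg (ExP 0 (Neg (EqP (Var 0) (Var 0))))"]) (auto simp: over_def holds_def)
next
  case (insert \<phi> \<Phi>)
  then obtain \<psi> where \<psi>: "fits \<psi> s" "over A \<psi>" "\<forall>t. holds M t \<psi> \<longleftrightarrow> (\<forall>\<phi>\<in>\<Phi>. holds M t \<phi>)" by auto
  have "fits (Conj \<phi> \<psi>) s" using insert.prems \<psi> by (auto simp: fits_def)
  moreover have "over A (Conj \<phi> \<psi>)" using insert.prems \<psi> by (auto simp: over_def)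
  moreover have "\<forall>t. holds M t (Conj \<phi> \<psi>) \<longleftrightarrow> (\<forall>\<phi>\<in>insert \<phi> \<Phi>. holds M t \<phi>)"
    using \<psi> by (auto simp: holds_def)
  ultimately show ?case by blast
qed

text \<open>Isomorphism of the enumerated induced substructures, respecting the positions of
  elements of \<open>A\<close>. Incidence with \<open>A\<close> is captured through these positions
  when \<open>A\<close> lies among the entries, as in \<open>copy_into_strong\<close>.\<close>

definition same_diagram ::
  "('p, 'l) incidence_structure \<Rightarrow> ('p + 'l) set \<Rightarrow> ('p + 'l) list \<Rightarrow> ('p + 'l) list \<Rightarrow> bool" where
  "same_diagram M A s t \<longleftrightarrow> map isl s = map isl t \<and>
     (\<forall>i<length s. \<forall>j<length s. (s ! i = s ! j \<longleftrightarrow> t ! i = t ! j) \<and>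
        (adj M (s ! i) (s ! j) \<longleftrightarrow> adj M (t ! i) (t ! j))) \<and>
     (\<forall>i<length s. \<forall>x\<in>A. s ! i = x \<longleftrightarrow> t ! i = x)"

text \<open>Only finitely many atoms are involved, so the formula can be the conjunction of those
  atoms and negated atoms that hold of \<open>s\<close>.\<close>

lemma diagram_formula:
  assumes "finite A"
  shows "\<exists>\<psi>. fits \<psi> s \<and> over A \<psi> \<and> holds M s \<psi> \<and>
    (\<forall>t. map isl t = map isl s \<longrightarrow> holds M t \<psi> \<longrightarrow> same_diagram M A s t)"
proof -
  define N where "N = {..<length s}"
  define At :: "('a, 'b) fm set" where
    "At = (\<lambda>(i, j). EqP (Var i) (Var j)) ` (N \<times> N) \<union> (\<lambda>(i, j). EqL (Var i) (Var j)) ` (N \<times> N) \<union>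
      (\<lambda>(i, j). Inc (Var i) (Var j)) ` (N \<times> N) \<union>
      (\<lambda>(i, p). EqP (Var i) (Param p)) ` (N \<times> Inl -` A) \<union>
      (\<lambda>(i, l). EqL (Var i) (Param l)) ` (N \<times> Inr -` A)"
  \<comment> \<open>Requiring \<open>fits\<close> drops atoms that use an index at the wrong sort,
    where \<open>projl\<close> or \<open>projr\<close> would be unspecified.\<close>
  define L where "L = {\<phi> \<in> At \<union> Neg ` At. fits \<phi> s \<and> over A \<phi> \<and> holds M s \<phi>}"
  have atoms: "EqP (Var i) (Var j) \<in> At" "EqL (Var i) (Var j) \<in> At" "Inc (Var i) (Var j) \<in> At"
    if "i < length s" "j < length s" for i j
    using that unfolding At_def N_def by (auto simp: image_iff)
  have atoms_param: "Inl p \<in> A \<Longrightarrow> EqP (Var i) (Param p) \<in> At"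
      "Inr l \<in> A \<Longrightarrow> EqL (Var i) (Param l) \<in> At"
    if "i < length s" for i p l
    using that unfolding At_def N_def by (auto simp: image_iff)
  have "finite N" by (simp add: N_def)
  then have "finite At" using assms by (simp add: At_def finite_vimageI)
  then have "finite L" by (simp add: L_def)
  moreover have "\<forall>\<phi>\<in>L. fits \<phi> s \<and> over A \<phi>" by (simp add: L_def)
  ultimately obtain \<psi> where \<psi>: "fits \<psi> s" "over A \<psi>"
    and h: "\<And>t. holds M t \<psi> \<longleftrightarrow> (\<forall>\<phi>\<in>L. holds M t \<phi>)"
    using finite_conjunction[of L s A M] by blast
  have "same_diagram M A s t" if t: "map isl t = map isl s" "holds M t \<psi>" for t
  proof -
    have iff: "holds M s \<phi> \<longleftrightarrow> holds M t \<phi>" if "\<phi> \<in> At" "fits \<phi> s" "over A \<phi>" for \<phi>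
    proof (cases "holds M s \<phi>")
      case True
      then show ?thesis using that t(2) h by (simp add: L_def)
    next
      case False
      then have "Neg \<phi> \<in> L" using that by (simp add: L_def fits_def over_def holds_def)
      then have "holds M t (Neg \<phi>)" using t(2) h by blast
      then show ?thesis using False by (simp add: holds_def)
    qed
    have srt: "isl (t ! i) = isl (s ! i)" if "i < length s" for i
      using map_isl_eqD[OF t(1) that] .
    have eq: "s ! i = s ! j \<longleftrightarrow> t ! i = t ! j" if ij: "i < length s" "j < length s" for i j
    proof (cases "isl (s ! i) = isl (s ! j)")
      case False
      then show ?thesis using srt[OF ij(1)] srt[OF ij(2)] by auto
    next
      case True
      then consider "isl (s ! i)" "isl (s ! j)" | "\<not> isl (s ! i)" "\<not> isl (s ! j)" by blast
      then show ?thesis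
      proof cases
        case 1
        have "projl (s ! i) = projl (s ! j) \<longleftrightarrow> projl (t ! i) = projl (t ! j)"
          using iff[of "EqP (Var i) (Var j)"] ij 1
          by (auto simp: atoms atoms_param fits_def over_def holds_def Plus_def)
        then show ?thesis using 1 srt[OF ij(1)] srt[OF ij(2)] by (metis sum.expand)
      next
        case 2
        have "projr (s ! i) = projr (s ! j) \<longleftrightarrow> projr (t ! i) = projr (t ! j)"
          using iff[of "EqL (Var i) (Var j)"] ij 2
          by (auto simp: atoms atoms_param fits_def over_def holds_def Plus_def)
        then show ?thesis using 2 srt[OF ij(1)] srt[OF ij(2)] by (metis sum.expand)
      qed
    qed
    have par: "s ! i = x \<longleftrightarrow> t ! i = x" if ix: "i < length s" "x \<in> A" for i x
    proof (cases "isl (s ! i) = isl x")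
      case False
      then show ?thesis using srt[OF ix(1)] by auto
    next
      case True
      show ?thesis
      proof (cases x)
        case (Inl p)
        have "projl (s ! i) = p \<longleftrightarrow> projl (t ! i) = p"
          using iff[of "EqP (Var i) (Param p)"] ix True Inl
          by (auto simp: atoms atoms_param fits_def over_def holds_def Plus_def)
        then show ?thesis using True Inl srt[OF ix(1)] by (metis sum.collapse(1) sum.disc(1) sum.sel(1))
      next
        case (Inr p)
        have "projr (s ! i) = p \<longleftrightarrow> projr (t ! i) = p"
          using iff[of "EqL (Var i) (Param p)"] ix True Inr
          by (auto simp: atoms atoms_param fits_def over_def holds_def Plus_def)
        then show ?thesis using True Inr srt[OF ix(1)] by (metis sum.collapse(2) sum.disc(2) sum.sel(2))
      qed
    qed
    have inc: "adj M (s ! i) (s ! j) \<longleftrightarrow> adj M (t ! i) (t ! j)"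
      if ij: "i < length s" "j < length s" "isl (s ! i)" "\<not> isl (s ! j)" for i j
    proof -
      have "(projl (s ! i), projr (s ! j)) \<in> incidence M \<longleftrightarrow>
          (projl (t ! i), projr (t ! j)) \<in> incidence M"
        using iff[of "Inc (Var i) (Var j)"] ij
        by (auto simp: atoms atoms_param fits_def over_def holds_def Plus_def)
      then show ?thesis
        using ij srt[OF ij(1)] srt[OF ij(2)] by (metis adj_Inl_Inr sum.collapse)
    qed
    \<comment> \<open>\<open>inc\<close> treats a point followed by a line; the opposite order
      follows by symmetry, and entries of equal sort are never adjacent.\<close>
    have "adj M (s ! i) (s ! j) \<longleftrightarrow> adj M (t ! i) (t ! j)"
      if ij: "i < length s" "j < length s" for i j
      using inc[of i j] inc[of j i] ij srt[OF ij(1)] srt[OF ij(2)] adj_isl adj_commute by metis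
    then show ?thesis using t(1) eq par by (simp add: same_diagram_def)
  qed
  moreover have "holds M s \<psi>" using h by (simp add: L_def)
  ultimately show ?thesis using \<psi> by blast
qed

lemma type_over_sorts:
  assumes "type_over M A a = type_over M A b"
  shows "map isl a = map isl b"
proof -
  have p: "EqP (Var i) (Var i) \<in> type_over M A a \<longleftrightarrow> i < length a \<and> isl (a ! i)"
    and l: "EqL (Var i) (Var i) \<in> type_over M A a \<longleftrightarrow> i < length a \<and> \<not> isl (a ! i)" for a i
    by (auto simp: type_over_def)
  have "i < length a \<longleftrightarrow> i < length b" for i using p[of i a] p[of i b] l[of i a] l[of i b] assms by auto
  then have "length a = length b" by (meson linorder_neq_iff)
  moreover have "isl (a ! i) = isl (b ! i)" if "i < length a" for i
    using p[of i a] p[of i b] that assms \<open>length a = length b\<close> by auto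
  ultimately show ?thesis by (simp add: list_eq_iff_nth_eq)
qed

text \<open>The diagram of \<open>a @ c\<close> with the entries of \<open>c\<close> quantified out
  is in the type of \<open>a\<close>, hence in that of \<open>b\<close>; its witnesses there form
  \<open>d\<close>.\<close>

lemma type_over_realize:
  assumes ty: "type_over M A a = type_over M A b" and "finite A" and c: "set c \<subseteq> elements M"
  shows "\<exists>d. set d \<subseteq> elements M \<and> same_diagram M A (a @ c) (b @ d)"
proof -
  obtain \<phi> where \<phi>: "fits \<phi> (a @ c)" "over A \<phi>" "holds M (a @ c) \<phi>"
    and diag: "\<And>t. map isl t = map isl (a @ c) \<Longrightarrow> holds M t \<phi> \<Longrightarrow> same_diagram M A (a @ c) t"
    using diagram_formula[OF assms(2), of "a @ c" M] by blast
  obtain \<psi> where \<psi>: "fits \<psi> a" "over A \<psi>" "holds M a \<psi>"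
    and ex: "\<And>b. map isl b = map isl a \<Longrightarrow> holds M b \<psi> \<Longrightarrow>
      \<exists>d. set d \<subseteq> elements M \<and> map isl d = map isl c \<and> holds M (b @ d) \<phi>"
    using exists_tuple[OF \<phi> c] by blast
  have "\<psi> \<in> type_over M A a" using \<psi> by (simp add: type_over_alt)
  then have "\<psi> \<in> type_over M A b" using ty by simp
  then have "holds M b \<psi>" by (simp add: type_over_alt)
  moreover have "map isl b = map isl a" using type_over_sorts[OF ty] by simp
  ultimately show ?thesis using ex[of b] diag by fastforce
qed

section \<open>Invariance of satisfaction and of types under automorphisms\<close>

lemma automorphism_sat:
  assumes M: "automorphism M f g"
    and "\<forall>p\<in>point_params \<phi>. p \<in> points M \<and> f p = p" "\<forall>l\<in>line_params \<phi>. l \<in> lines M \<and> g l = l"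
    and "\<forall>i\<in>free_point_vars \<phi>. v i \<in> points M \<and> v' i = f (v i)"
    and "\<forall>i\<in>free_line_vars \<phi>. w i \<in> lines M \<and> w' i = g (w i)"
  shows "sat M v w \<phi> \<longleftrightarrow> sat M v' w' \<phi>"
  using assms(2-)
proof (induction \<phi> arbitrary: v v' w w')
  have tm: "tm_val v t \<in> S \<and> tm_val v' t = h (tm_val v t)"
    if "\<forall>p\<in>params t. p \<in> S \<and> h p = p" "\<forall>i\<in>tm_vars t. v i \<in> S \<and> v' i = h (v i)"
    for t :: "'c tm" and v v' h S
    using that by (cases t) auto
  have f: "bij_betw f (points M) (points M)" and g: "bij_betw g (lines M) (lines M)"
    and inc: "\<And>p l. p \<in> points M \<Longrightarrow> l \<in> lines M \<Longrightarrow> (f p, g l) \<in> incidence M \<longleftrightarrow> (p, l) \<in> incidence M"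
    using M by (auto simp: automorphism_def)
  {
    case (EqP s t)
    then show ?case
      using tm[of s "points M" f v v'] tm[of t "points M" f v v'] f
      by (auto simp: bij_betw_def inj_on_def)
  next
    case (EqL s t)
    then show ?case
      using tm[of s "lines M" g w w'] tm[of t "lines M" g w w'] g
      by (auto simp: bij_betw_def inj_on_def)
  next
    case (Inc s t)
    then show ?case
      using tm[of s "points M" f v v'] tm[of t "lines M" g w w'] inc by auto
  next
    case (Neg \<phi>)
    have "sat M v w \<phi> \<longleftrightarrow> sat M v' w' \<phi>" by (rule Neg.IH) (use Neg.prems in auto)
    then show ?case by simp
  next
    case (Conj \<phi> \<psi>)
    have "sat M v w \<phi> \<longleftrightarrow> sat M v' w' \<phi>" "sat M v w \<psi> \<longleftrightarrow> sat M v' w' \<psi>"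
      by (rule Conj.IH; use Conj.prems in auto)+
    then show ?case by simp
  next
    case (ExP i \<phi>)
    have *: "sat M (v(i := p)) w \<phi> \<longleftrightarrow> sat M (v'(i := f p)) w' \<phi>" if "p \<in> points M" for p
      by (rule ExP.IH) (use ExP.prems that in auto)
    \<comment> \<open>A witness \<open>p\<close> becomes \<open>f p\<close>; since \<open>f\<close>
      is onto, the images again range over all points.\<close>
    have "(\<exists>p\<in>points M. sat M (v(i := p)) w \<phi>) \<longleftrightarrow> (\<exists>p\<in>f ` points M. sat M (v'(i := p)) w' \<phi>)"
      using * by simp
    then show ?case by (simp only: bij_betw_imp_surj_on[OF f] sat.simps)
  next
    case (ExL i \<phi>)
    have *: "sat M v (w(i := l)) \<phi> \<longleftrightarrow> sat M v' (w'(i := g l)) \<phi>" if "l \<in> lines M" for l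
      by (rule ExL.IH) (use ExL.prems that in auto)
    have "(\<exists>l\<in>lines M. sat M v (w(i := l)) \<phi>) \<longleftrightarrow> (\<exists>l\<in>g ` lines M. sat M v' (w'(i := l)) \<phi>)"
      using * by simp
    then show ?case by (simp only: bij_betw_imp_surj_on[OF g] sat.simps)
  }
qed

lemma automorphism_type_over:
  assumes M: "automorphism M f g" and a: "set a \<subseteq> elements M" and A: "A \<subseteq> elements M"
    and fixA: "\<forall>x\<in>A. map_sum f g x = x"
  shows "type_over M A (map (map_sum f g) a) = type_over M A a"
proof -
  define b where "b = map (map_sum f g) a"
  have islb: "isl (b ! i) = isl (a ! i)" if "i < length a" for i
    using that by (cases "a ! i") (auto simp: b_def)
  have fits: "fits \<phi> b \<longleftrightarrow> fits \<phi> a" for \<phi>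
    using islb unfolding fits_def b_def length_map by (metis (mono_tags, lifting) Collect_cong)
  have "holds M b \<phi> \<longleftrightarrow> holds M a \<phi>" if \<phi>: "over A \<phi>" "fits \<phi> a" for \<phi>
  proof -
    have v: "projl (a ! i) \<in> points M \<and> projl (b ! i) = f (projl (a ! i))"
      if "i < length a" "isl (a ! i)" for i
      using that a nth_mem[OF that(1)] by (cases "a ! i") (auto simp: b_def elements_def)
    have w: "projr (a ! i) \<in> lines M \<and> projr (b ! i) = g (projr (a ! i))"
      if "i < length a" "\<not> isl (a ! i)" for i
      using that a nth_mem[OF that(1)] by (cases "a ! i") (auto simp: b_def elements_def)
    have pp: "p \<in> points M \<and> f p = p" if "p \<in> point_params \<phi>" for p
    proof -
      have "Inl p \<in> A" using that \<phi> by (auto simp: over_def)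
      then show ?thesis using A fixA by (metis Inl_elements map_sum.simps(1) subsetD sum.inject(1))
    qed
    have lp: "p \<in> lines M \<and> g p = p" if "p \<in> line_params \<phi>" for p
    proof -
      have "Inr p \<in> A" using that \<phi> by (auto simp: over_def)
      then show ?thesis using A fixA by (metis Inr_elements map_sum.simps(2) subsetD sum.inject(2))
    qed
    have "sat M (\<lambda>i. projl (a ! i)) (\<lambda>i. projr (a ! i)) \<phi> \<longleftrightarrow>
        sat M (\<lambda>i. projl (b ! i)) (\<lambda>i. projr (b ! i)) \<phi>"
      by (rule automorphism_sat[OF M]) (use v w pp lp \<phi>(2) in \<open>auto simp: fits_def\<close>)
    then show ?thesis by (simp add: holds_def)
  qed
  then show ?thesis using fits unfolding type_over_alt b_def by blast
qed

section \<open>From equal types to isomorphic minimal strong sets\<close>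

section \<open>Homogeneity\<close>

context generic_plane
begin

text \<open>Take \<open>C\<close> of least cardinality: an element outside \<open>S\<close> of
  degree at most two could be deleted by \<open>strong_remove\<close>.\<close>

lemma minimal_strong:
  assumes "finite S" "S \<subseteq> elements M"
  shows "\<exists>C. finite C \<and> S \<subseteq> C \<and> strong M C \<and> (\<forall>x\<in>C - S. 2 < card (nbrs M x C))"
proof -
  let ?P = "\<lambda>C. finite C \<and> S \<subseteq> C \<and> strong M C"
  obtain C0 where "?P C0" using finite_strong[OF assms] ..
  then have "\<exists>C. ?P C \<and> (\<forall>D. ?P D \<longrightarrow> card C \<le> card D)" by (rule ex_has_least_nat)
  then obtain C where C: "?P C \<and> (\<forall>D. ?P D \<longrightarrow> card C \<le> card D)" ..
  have "2 < card (nbrs M x C)" if x: "x \<in> C - S" for x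
  proof (rule ccontr)
    assume "\<not> ?thesis"
    moreover have "card (nbrs M x (C - {x})) \<le> card (nbrs M x C)"
      by (rule card_nbrs_mono) (use C in auto)
    moreover have "insert x (C - {x}) = C" using x by auto
    ultimately have "strong M (C - {x})"
      using strong_remove[of M x "C - {x}"] C by auto
    then have "?P (C - {x})" using C x by auto
    then have "card C \<le> card (C - {x})" using C by simp
    then show False using x C by (metis DiffD1 card_Diff1_less leD)
  qed
  then show ?thesis using C by blast
qed

text \<open>Otherwise \<open>D - C\<close> contradicts strength of \<open>C\<close>: its elements
  lie outside \<open>S\<close>, so each has more than two neighbours in \<open>D\<close>, hence in
  \<open>C \<union> (D - C)\<close>.\<close>

lemma subset_strong:
  assumes C: "finite C" "strong M C" "S \<subseteq> C"
    and D: "finite D" "D \<subseteq> elements M" "\<forall>x\<in>D - S. 2 < card (nbrs M x D)"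
  shows "D \<subseteq> C"
proof (rule ccontr)
  assume "\<not> D \<subseteq> C"
  then have "\<exists>e\<in>D - C. card (nbrs M e (C \<union> (D - C))) \<le> 2"
    by (intro strongD[OF C(2)]) (use D in auto)
  then obtain e where e: "e \<in> D - C" "card (nbrs M e (C \<union> (D - C))) \<le> 2" ..
  have "card (nbrs M e D) \<le> card (nbrs M e (C \<union> (D - C)))"
    by (rule card_nbrs_mono) (use C D in auto)
  moreover have "2 < card (nbrs M e D)" using D(3) e(1) C(3) by blast
  ultimately show False using e(2) by linarith
qed

text \<open>Being strong is not first order, so the formula realizing the diagram of \<open>C\<close> only yields a
  copy of it. The degree condition on \<open>C\<close> is first order; it confines the copy to every strong
  superset of \<open>b\<close> and \<open>A\<close>.\<close>

lemma copy_into_strong: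
  assumes ty: "type_over M A a = type_over M A b" and A: "finite A"
    and C: "finite C" "set a \<union> A \<subseteq> C" "strong M C"
      "\<forall>x\<in>C - (set a \<union> A). 2 < card (nbrs M x C)"
    and C': "finite C'" "set b \<union> A \<subseteq> C'" "strong M C'"
  shows "\<exists>R. finite R \<and> Domain R = C \<and> Range R \<subseteq> C' \<and> card (Range R) = card C \<and>
    (\<forall>x y. (x, y) \<in> R \<longrightarrow> isl x = isl y) \<and>
    (\<forall>x y x' y'. (x, y) \<in> R \<longrightarrow> (x', y') \<in> R \<longrightarrow>
        (x = x' \<longleftrightarrow> y = y') \<and> (adj M x x' \<longleftrightarrow> adj M y y')) \<and>
    (\<forall>x\<in>A. (x, x) \<in> R) \<and> set (zip a b) \<subseteq> R"
proof -
  obtain c where c: "set c = C" using finite_list[OF C(1)] by blast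
  obtain d where d: "set d \<subseteq> elements M" "same_diagram M A (a @ c) (b @ d)"
    using type_over_realize[OF ty A, of c] strong_subset[OF C(3)] c by blast
  define s where "s = a @ c"
  define t where "t = b @ d"
  have set_s: "set s = C" using c C(2) by (auto simp: s_def)
  have len: "length t = length s" and leni: "length a = length b"
    using d(2) type_over_sorts[OF ty] map_eq_imp_length_eq unfolding s_def t_def same_diagram_def
    by metis+
  have dg: "same_diagram M A s t" using d by (simp add: s_def t_def)
  define R where "R = set (zip s t)"
  have R: "(x, y) \<in> R \<longleftrightarrow> (\<exists>i<length s. x = s ! i \<and> y = t ! i)" for x y
    using len by (auto simp: R_def set_zip)
  have Dom: "Domain R = C"
    using R unfolding set_s[symmetric] by (auto simp: in_set_conv_nth Domain_iff)
  have Ran: "Range R = set t"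
    using R len by (auto simp: in_set_conv_nth Range_iff)
  have srt: "isl x = isl y" if "(x, y) \<in> R" for x y
    using that R dg map_isl_eqD unfolding same_diagram_def by metis
  have eq: "x = x' \<longleftrightarrow> y = y'" and ad: "adj M x x' \<longleftrightarrow> adj M y y'"
    if "(x, y) \<in> R" "(x', y') \<in> R" for x y x' y'
    using that R dg unfolding same_diagram_def by metis+
  have fixA: "(x, x) \<in> R" if x: "x \<in> A" for x
  proof -
    obtain y where y: "(x, y) \<in> R" using Dom x C(2) by blast
    then show ?thesis using R dg x unfolding same_diagram_def by metis
  qed
  have zipR: "set (zip a b) \<subseteq> R" using leni by (simp add: R_def s_def t_def)
  define h where "h x = (SOME y. (x, y) \<in> R)" for x
  have h: "(x, h x) \<in> R" if "x \<in> C" for x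
    unfolding h_def using that Dom by (metis Domain_iff someI_ex)
  have hR: "h x = y" if "(x, y) \<in> R" for x y using eq[OF that h] that Dom by blast
  have inj: "inj_on h C"
    using eq h by (meson inj_onI)
  have img: "h ` C = set t"
    unfolding Ran[symmetric] using h hR Dom by (auto simp: image_iff Range_iff)
  have card: "card (Range R) = card C" using card_image[OF inj] img Ran by simp
  have "set b \<subseteq> elements M" using C' strong_subset by blast
  then have tV: "set t \<subseteq> elements M" using d(1) by (simp add: t_def)
  have "set t \<subseteq> C'"
  proof (rule subset_strong[OF C'(1,3,2)])
    show "\<forall>y\<in>set t - (set b \<union> A). 2 < card (nbrs M y (set t))"
    proof
      fix y assume y: "y \<in> set t - (set b \<union> A)"
      then obtain x where x: "(x, y) \<in> R" using Ran by blast
      \<comment> \<open>\<open>R\<close> sends \<open>a\<close> to \<open>b\<close> entry by entry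
        and fixes \<open>A\<close>, so \<open>y\<close> comes from an element outside both
        \<open>a\<close> and \<open>A\<close>. There the degree condition holds, and
        \<open>h\<close> carries it over to \<open>y\<close>.\<close>
      have "x \<notin> set a"
      proof
        assume "x \<in> set a"
        then obtain i where "i < length a" "x = a ! i" by (auto simp: in_set_conv_nth)
        then have "(x, b ! i) \<in> R" using zipR leni by (auto simp: set_zip)
        then show False using eq[OF x] y leni \<open>i < length a\<close> by force
      qed
      moreover have "x \<notin> A" using fixA x eq y by blast
      moreover have "x \<in> C" using x Dom by blast
      ultimately have "2 < card (nbrs M x C)" using C(4) by blast
      also have "card (nbrs M x C) = card (h ` nbrs M x C)"
        by (rule card_image[symmetric]) (use inj in \<open>auto intro: inj_on_subset\<close>)
      also have "\<dots> \<le> card (nbrs M y (set t))"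
        by (rule card_mono) (use ad[OF x h] C(1) in \<open>auto simp: img[symmetric]\<close>)
      finally show "2 < card (nbrs M y (set t))" .
    qed
  qed (use tV in auto)
  then show ?thesis
    using Dom Ran card srt eq ad fixA zipR
    by (intro exI[of _ R]) (auto simp: R_def)
qed

theorem strongly_type_homogeneous:
  assumes a: "set a \<subseteq> elements M" and b: "set b \<subseteq> elements M"
    and A: "A \<subseteq> elements M" "finite A"
  shows "type_over M A a = type_over M A b \<longleftrightarrow>
    (\<exists>f g. automorphism M f g \<and> (\<forall>x\<in>A. map_sum f g x = x) \<and> map (map_sum f g) a = b)"
proof
  assume ty: "type_over M A a = type_over M A b"
  obtain C where C: "finite C" "set a \<union> A \<subseteq> C" "strong M C"
      "\<forall>x\<in>C - (set a \<union> A). 2 < card (nbrs M x C)"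
    using minimal_strong[of "set a \<union> A"] a A by auto
  obtain C' where C': "finite C'" "set b \<union> A \<subseteq> C'" "strong M C'"
      "\<forall>x\<in>C' - (set b \<union> A). 2 < card (nbrs M x C')"
    using minimal_strong[of "set b \<union> A"] b A by auto
  obtain R where R: "finite R" "Domain R = C" "Range R \<subseteq> C'" "card (Range R) = card C"
    "\<forall>x y. (x, y) \<in> R \<longrightarrow> isl x = isl y"
    "\<forall>x y x' y'. (x, y) \<in> R \<longrightarrow> (x', y') \<in> R \<longrightarrow>
        (x = x' \<longleftrightarrow> y = y') \<and> (adj M x x' \<longleftrightarrow> adj M y y')"
    "\<forall>x\<in>A. (x, x) \<in> R" "set (zip a b) \<subseteq> R"
    using copy_into_strong[OF ty A(2) C C'(1-3)] by blast
  \<comment> \<open>Copying in the opposite direction gives \<open>card C' \<le> card C\<close>. The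
    first copy has \<open>card C\<close> elements and lies inside \<open>C'\<close>, so it fills
    \<open>C'\<close>.\<close>
  obtain Q :: "(('p + 'l) \<times> ('p + 'l)) set" where "Range Q \<subseteq> C" "card (Range Q) = card C'"
    using copy_into_strong[OF ty[symmetric] A(2) C' C(1-3)] by blast
  then have "card C' \<le> card (Range R)" using card_mono[OF C(1)] R(4) by metis
  then have "Range R = C'" using card_seteq[OF C'(1) R(3)] by blast
  \<comment> \<open>The range is strong because it is \<open>C'\<close>; the diagram alone would not
    show this.\<close>
  then have "piso R" using R C C' unfolding piso_def by blast
  then obtain f g where fg: "automorphism M f g" "\<forall>(x, y)\<in>R. map_sum f g x = y"
    using piso_automorphism by blast
  have len: "length a = length b" using type_over_sorts[OF ty] map_eq_imp_length_eq by blast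
  have "map (map_sum f g) a = b"
  proof (rule nth_equalityI)
    fix i assume "i < length (map (map_sum f g) a)"
    then have i: "i < length a" "(a ! i, b ! i) \<in> R" using R(8) len by (auto simp: set_zip)
    then show "map (map_sum f g) a ! i = b ! i" using fg(2) by auto
  qed (use len in simp)
  moreover have "\<forall>x\<in>A. map_sum f g x = x" using R(7) fg(2) by fast
  ultimately show "\<exists>f g. automorphism M f g \<and> (\<forall>x\<in>A. map_sum f g x = x) \<and> map (map_sum f g) a = b"
    using fg(1) by blast
next
  assume "\<exists>f g. automorphism M f g \<and> (\<forall>x\<in>A. map_sum f g x = x) \<and> map (map_sum f g) a = b"
  then obtain f g where fg: "automorphism M f g" "\<forall>x\<in>A. map_sum f g x = x" "map (map_sum f g) a = b"
    by blast
  then show "type_over M A a = type_over M A b"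
    using automorphism_type_over[OF fg(1) a A(1) fg(2)] by simp
qed

end

section \<open>Incidence axioms, countability and ancestry in free extensions\<close>

section \<open>Free extensions\<close>

lemma elements_free_stage_mono:
  assumes "m \<le> n"
  shows "elements (free_stage P m) \<subseteq> elements (free_stage P n)"
proof (rule lift_Suc_mono_le[OF _ assms])
  show "elements (free_stage P k) \<subseteq> elements (free_stage P (Suc k))" for k
    by (auto simp: elements_def add_joins_def add_meets_def)
qed

lemma incidence_free_stage_mono:
  assumes "m \<le> n"
  shows "incidence (free_stage P m) \<subseteq> incidence (free_stage P n)"
proof (rule lift_Suc_mono_le[OF _ assms])
  show "incidence (free_stage P k) \<subseteq> incidence (free_stage P (Suc k))" for k
    by (auto simp: add_joins_def add_meets_def)
qed

lemma elements_free_extension: "elements (free_extension P) = (\<Union>n. elements (free_stage P n))"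
  by (auto simp: elements_def free_extension_def)

lemma incidence_free_extension: "incidence (free_extension P) = (\<Union>n. incidence (free_stage P n))"
  by (simp add: free_extension_def)

lemma set_uprod_pair: "p \<in> set_uprod u \<Longrightarrow> q \<in> set_uprod u \<Longrightarrow> p \<noteq> q \<Longrightarrow> u = Upair p q"
  by (cases u) auto

text \<open>Both uniqueness axioms say that the incidence graph has no 4-cycle, expressed by
  \<open>p = q \<or> l = m\<close>. An added line carries a single pair of distinct points, and that
  pair was unjoined, so no cycle arises; dually for added points.\<close>

lemma partial_plane_free_stage:
  assumes "partial_plane P"
  shows "incidence (free_stage P n) \<subseteq> points (free_stage P n) \<times> lines (free_stage P n) \<and>
    (\<forall>p q l m. (p, l) \<in> incidence (free_stage P n) \<longrightarrow> (q, l) \<in> incidence (free_stage P n) \<longrightarrow>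
      (p, m) \<in> incidence (free_stage P n) \<longrightarrow> (q, m) \<in> incidence (free_stage P n) \<longrightarrow>
      p = q \<or> l = m)"
proof (induction n)
  case 0
  have inc: "(p, l) \<in> incidence (free_stage P 0) \<longleftrightarrow>
      (\<exists>q m. p = OldPoint q \<and> l = OldLine m \<and> (q, m) \<in> incidence P)" for p l
    by (auto simp: old_part_def)
  have sub: "incidence P \<subseteq> points P \<times> lines P" using assms by (simp add: partial_plane_def)
  then have "p = q \<or> l = m" if "(p, l) \<in> incidence P" "(q, l) \<in> incidence P"
    "(p, m) \<in> incidence P" "(q, m) \<in> incidence P" for p q l m
    using assms that unfolding partial_plane_def by blast
  then have "\<forall>p q l m. (p, l) \<in> incidence (free_stage P 0) \<longrightarrow> (q, l) \<in> incidence (free_stage P 0) \<longrightarrow>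
      (p, m) \<in> incidence (free_stage P 0) \<longrightarrow> (q, m) \<in> incidence (free_stage P 0) \<longrightarrow>
      p = q \<or> l = m"
    unfolding inc by blast
  moreover have "incidence (free_stage P 0) \<subseteq> points (free_stage P 0) \<times> lines (free_stage P 0)"
    using sub by (auto simp: old_part_def)
  ultimately show ?case by blast
next
  case (Suc n)
  define M where "M = free_stage P n"
  have sub: "incidence M \<subseteq> points M \<times> lines M"
    and uniq: "\<And>p q l m. (p, l) \<in> incidence M \<Longrightarrow> (q, l) \<in> incidence M \<Longrightarrow>
      (p, m) \<in> incidence M \<Longrightarrow> (q, m) \<in> incidence M \<Longrightarrow> p = q \<or> l = m"
    using Suc by (auto simp: M_def)
  show ?case
  proof (cases "even n")
    case True
    then have S: "free_stage P (Suc n) = add_joins M" by (simp add: M_def)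
    have new: "Join u \<notin> lines M" if "u \<in> unjoined_pairs M" for u
      using added_lines_new that by (simp add: M_def)
    have cs: "(p, l) \<in> incidence M \<and> (q, l) \<in> incidence M \<or>
        l = Join (Upair p q) \<and> Upair p q \<in> unjoined_pairs M"
      if "(p, l) \<in> incidence (add_joins M)" "(q, l) \<in> incidence (add_joins M)" "p \<noteq> q" for p q l
      using that new sub by (auto simp: add_joins_def dest: set_uprod_pair)
    have old: "\<not> ((p, l) \<in> incidence M \<and> (q, l) \<in> incidence M)"
      if "Upair p q \<in> unjoined_pairs M" for p q l
      using that sub by (auto simp: unjoined_pairs_def)
    have "l = m" if "(p, l) \<in> incidence (add_joins M)" "(q, l) \<in> incidence (add_joins M)"
      "(p, m) \<in> incidence (add_joins M)" "(q, m) \<in> incidence (add_joins M)" "p \<noteq> q" for p q l m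
      using cs[OF that(1,2,5)] cs[OF that(3,4,5)] old uniq that(5) by blast
    moreover have "incidence (add_joins M) \<subseteq> points (add_joins M) \<times> lines (add_joins M)"
    proof -
      have "p \<in> points M" if "u \<in> unjoined_pairs M" "p \<in> set_uprod u" for u p
        using that by (auto simp: unjoined_pairs_def)
      then show ?thesis using sub by (auto simp: add_joins_def)
    qed
    ultimately show ?thesis unfolding S by blast
  next
    case False
    then have S: "free_stage P (Suc n) = add_meets M" by (simp add: M_def)
    have new: "Meet u \<notin> points M" if "u \<in> unmet_pairs M" for u
      using added_points_new that by (simp add: M_def)
    have cs: "(p, l) \<in> incidence M \<and> (p, m) \<in> incidence M \<or>
        p = Meet (Upair l m) \<and> Upair l m \<in> unmet_pairs M"
      if "(p, l) \<in> incidence (add_meets M)" "(p, m) \<in> incidence (add_meets M)" "l \<noteq> m" for p l m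
      using that new sub by (auto simp: add_meets_def dest: set_uprod_pair)
    have old: "\<not> ((p, l) \<in> incidence M \<and> (p, m) \<in> incidence M)"
      if "Upair l m \<in> unmet_pairs M" for p l m
      using that sub by (auto simp: unmet_pairs_def)
    have "p = q" if "(p, l) \<in> incidence (add_meets M)" "(p, m) \<in> incidence (add_meets M)"
      "(q, l) \<in> incidence (add_meets M)" "(q, m) \<in> incidence (add_meets M)" "l \<noteq> m" for p q l m
      using cs[OF that(1,2,5)] cs[OF that(3,4,5)] old uniq that(5) by blast
    moreover have "incidence (add_meets M) \<subseteq> points (add_meets M) \<times> lines (add_meets M)"
    proof -
      have "l \<in> lines M" if "u \<in> unmet_pairs M" "l \<in> set_uprod u" for u l
        using that by (auto simp: unmet_pairs_def)
      then show ?thesis using sub by (auto simp: add_meets_def)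
    qed
    ultimately show ?thesis unfolding S by blast
  qed
qed

lemma two_elements_stage:
  assumes "x \<in> elements (free_extension P)" "y \<in> elements (free_extension P)"
  shows "\<exists>n. x \<in> elements (free_stage P n) \<and> y \<in> elements (free_stage P n)"
proof -
  obtain i j where "x \<in> elements (free_stage P i)" "y \<in> elements (free_stage P j)"
    using assms by (auto simp: elements_free_extension)
  moreover define n where "n = max i j"
  moreover have "i \<le> n" "j \<le> n" by (auto simp: n_def)
  ultimately show ?thesis using elements_free_stage_mono by blast
qed

lemma incidence_free_extension_subset:
  assumes "partial_plane P"
  shows "incidence (free_extension P) \<subseteq> points (free_extension P) \<times> lines (free_extension P)"
  using partial_plane_free_stage[OF assms] by (fastforce simp: free_extension_def)

lemma common_nbr_unique_free_extension:
  assumes P: "partial_plane P" and "x \<noteq> y"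
    and adj: "adj (free_extension P) x z" "adj (free_extension P) y z"
      "adj (free_extension P) x w" "adj (free_extension P) y w"
  shows "z = w"
proof -
  have uniq: "p = q \<or> l = m" if h: "(p, l) \<in> incidence (free_extension P)"
    "(q, l) \<in> incidence (free_extension P)"
    "(p, m) \<in> incidence (free_extension P)" "(q, m) \<in> incidence (free_extension P)" for p q l m
  proof -
    obtain i j k n where ijkn: "(p, l) \<in> incidence (free_stage P i)" "(q, l) \<in> incidence (free_stage P j)"
      "(p, m) \<in> incidence (free_stage P k)" "(q, m) \<in> incidence (free_stage P n)"
      using h by (auto simp: incidence_free_extension)
    define N where "N = max (max i j) (max k n)"
    have "i \<le> N" "j \<le> N" "k \<le> N" "n \<le> N" by (auto simp: N_def)
    then have "(p, l) \<in> incidence (free_stage P N)" "(q, l) \<in> incidence (free_stage P N)"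
      "(p, m) \<in> incidence (free_stage P N)" "(q, m) \<in> incidence (free_stage P N)"
      using ijkn incidence_free_stage_mono by blast+
    then show ?thesis using partial_plane_free_stage[OF P] by blast
  qed
  show ?thesis
  proof (cases x)
    case (Inl p)
    then obtain l m where "z = Inr l" "w = Inr m" using adj by (auto simp: adj_def)
    then show ?thesis using Inl adj uniq \<open>x \<noteq> y\<close> by (cases y) (auto simp: adj_def)
  next
    case (Inr p)
    then obtain l m where "z = Inl l" "w = Inl m" using adj by (auto simp: adj_def)
    then show ?thesis using Inr adj uniq \<open>x \<noteq> y\<close> by (cases y) (auto simp: adj_def)
  qed
qed

lemma common_nbr_free_extension:
  assumes "x \<in> elements (free_extension P)" "y \<in> elements (free_extension P)" "x \<noteq> y" "isl x = isl y"
  shows "\<exists>z. adj (free_extension P) x z \<and> adj (free_extension P) y z"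
proof -
  obtain n where n: "x \<in> elements (free_stage P n)" "y \<in> elements (free_stage P n)"
    using two_elements_stage[OF assms(1,2)] by blast
  \<comment> \<open>Joins are added after even stages and meets after odd ones; these are stages of
    either parity that already contain both elements.\<close>
  have le: "n \<le> 2 * n" "n \<le> Suc (2 * n)" by auto
  have inc: "(p, l) \<in> incidence (free_extension P)" if "(p, l) \<in> incidence (free_stage P k)" for p l k
    using that by (auto simp: incidence_free_extension)
  show ?thesis
  proof (cases x)
    case (Inl p)
    then obtain q where q: "y = Inl q" using assms(4) by (cases y) auto
    define S where "S = free_stage P (2 * n)"
    have pq: "p \<in> points S" "q \<in> points S"
      using n[THEN subsetD[OF elements_free_stage_mono[OF le(1)]]] Inl q by (simp_all add: S_def)
    have S': "free_stage P (Suc (2 * n)) = add_joins S" by (simp add: S_def)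
    obtain l where "(p, l) \<in> incidence (add_joins S)" "(q, l) \<in> incidence (add_joins S)"
    proof (cases "\<exists>l\<in>lines S. (p, l) \<in> incidence S \<and> (q, l) \<in> incidence S")
      case True
      then show ?thesis using that by (auto simp: add_joins_def)
    next
      case False
      then have "Upair p q \<in> unjoined_pairs S"
        using pq assms(3) Inl q by (auto simp: unjoined_pairs_def)
      then show ?thesis using that[of "Join (Upair p q)"] by (auto simp: add_joins_def)
    qed
    then have "(p, l) \<in> incidence (free_extension P)" "(q, l) \<in> incidence (free_extension P)"
      using inc unfolding S'[symmetric] by blast+
    then show ?thesis using Inl q by (intro exI[of _ "Inr l"]) auto
  next
    case (Inr p)
    then obtain q where q: "y = Inr q" using assms(4) by (cases y) auto
    define S where "S = free_stage P (Suc (2 * n))"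
    have pq: "p \<in> lines S" "q \<in> lines S"
      using n[THEN subsetD[OF elements_free_stage_mono[OF le(2)]]] Inr q
      by (simp_all add: S_def del: free_stage.simps)
    have S': "free_stage P (Suc (Suc (2 * n))) = add_meets S" by (simp add: S_def)
    obtain l where "(l, p) \<in> incidence (add_meets S)" "(l, q) \<in> incidence (add_meets S)"
    proof (cases "\<exists>l\<in>points S. (l, p) \<in> incidence S \<and> (l, q) \<in> incidence S")
      case True
      then show ?thesis using that by (auto simp: add_meets_def)
    next
      case False
      then have "Upair p q \<in> unmet_pairs S"
        using pq assms(3) Inr q by (auto simp: unmet_pairs_def)
      then show ?thesis using that[of "Meet (Upair p q)"] by (auto simp: add_meets_def)
    qed
    then have "(l, p) \<in> incidence (free_extension P)" "(l, q) \<in> incidence (free_extension P)"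
      using inc unfolding S'[symmetric] by blast+
    then show ?thesis using Inr q by (intro exI[of _ "Inl l"]) (auto simp: adj_def)
  qed
qed

lemma countable_free_extension:
  assumes "countable (points P)" "countable (lines P)"
  shows "countable (elements (free_extension P))"
proof -
  have "countable (points (free_stage P n)) \<and> countable (lines (free_stage P n))" for n
  proof (induction n)
    case 0
    then show ?case using assms by (simp add: old_part_def)
  next
    case (Suc n)
    define M where "M = free_stage P n"
    have c: "countable (points M)" "countable (lines M)" using Suc by (auto simp: M_def)
    have "unjoined_pairs M \<subseteq> case_prod Upair ` (points M \<times> points M)"
      by (auto simp: unjoined_pairs_def)
    moreover have "unmet_pairs M \<subseteq> case_prod Upair ` (lines M \<times> lines M)"
      by (auto simp: unmet_pairs_def)
    ultimately have "countable (unjoined_pairs M)" "countable (unmet_pairs M)"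
      using c by (meson countable_SIGMA countable_image countable_subset)+
    then show ?case using c by (simp add: M_def[symmetric] add_joins_def add_meets_def)
  qed
  then have "countable (elements (free_stage P n))" for n by (simp add: elements_def Plus_def)
  then show ?thesis unfolding elements_free_extension by blast
qed

text \<open>The name of an added element records the pair that generated it, so ancestry can be read
  off without reference to a stage.\<close>

fun parents :: "('p, 'l) fpoint + ('p, 'l) fline \<Rightarrow> (('p, 'l) fpoint + ('p, 'l) fline) set" where
  "parents (Inl (OldPoint p)) = {}"
| "parents (Inl (Meet u)) = Inr ` set_uprod u"
| "parents (Inr (OldLine l)) = {}"
| "parents (Inr (Join u)) = Inl ` set_uprod u"

definition birth ::
  "('p, 'l) incidence_structure \<Rightarrow> ('p, 'l) fpoint + ('p, 'l) fline \<Rightarrow> nat" where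
  "birth P x = (LEAST n. x \<in> elements (free_stage P n))"

lemma parents_stage_0: "x \<in> elements (free_stage P 0) \<Longrightarrow> parents x = {}"
  by (auto simp: elements_def old_part_def)

lemma parents_stage_Suc:
  assumes "x \<in> elements (free_stage P (Suc n))"
  shows "x \<in> elements (free_stage P n) \<or> parents x \<subseteq> elements (free_stage P n)"
  using assms
  by (auto simp: elements_def add_joins_def add_meets_def unjoined_pairs_def unmet_pairs_def
      split: if_splits)

lemma card_set_uprod: "card (set_uprod u) \<le> 2"
  by (cases u) (simp add: card_insert_if)

lemma finite_parents: "finite (parents x)" and card_parents: "card (parents x) \<le> 2"
proof -
  have "finite (parents x) \<and> card (parents x) \<le> 2"
    by (cases x rule: parents.cases) (auto simp: card_image card_set_uprod)
  then show "finite (parents x)" "card (parents x) \<le> 2" by auto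
qed

text \<open>What is added at a stage has its parents in the preceding one. Birth at stage 0 is
  excluded, since the elements there have no parents.\<close>

lemma birth_parents:
  assumes "x \<in> elements (free_extension P)" "y \<in> parents x"
  shows "birth P y < birth P x"
proof -
  have "\<exists>n. x \<in> elements (free_stage P n)" using assms(1) by (auto simp: elements_free_extension)
  then have x: "x \<in> elements (free_stage P (birth P x))" unfolding birth_def by (rule LeastI_ex)
  then obtain n where n: "birth P x = Suc n"
    using parents_stage_0[of x P] assms(2) by (cases "birth P x") auto
  have "x \<notin> elements (free_stage P n)"
    using not_less_Least[of n "\<lambda>n. x \<in> elements (free_stage P n)"] n by (simp add: birth_def)
  then have "y \<in> elements (free_stage P n)"
    using parents_stage_Suc[of x P n] x n assms(2) by auto
  then have "birth P y \<le> n" unfolding birth_def by (rule Least_le)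
  then show ?thesis using n by simp
qed

text \<open>Induction on the stage: elements of \<open>S\<close> new at the last stage are replaced
  by their parents, the result is closed one stage earlier, and the new elements are put
  back.\<close>

lemma parent_closed_superset:
  assumes "finite S" "S \<subseteq> elements (free_stage P n)"
  shows "\<exists>D. finite D \<and> S \<subseteq> D \<and> D \<subseteq> elements (free_stage P n) \<and> (\<forall>x\<in>D. parents x \<subseteq> D)"
  using assms
proof (induction n arbitrary: S)
  case 0
  then show ?case using parents_stage_0 by (intro exI[of _ S]) blast
next
  case (Suc n)
  let ?V = "elements (free_stage P n)"
  define S' where "S' = S \<inter> ?V \<union> (\<Union>x\<in>S - ?V. parents x)"
  have "finite S'" using Suc.prems finite_parents by (auto simp: S'_def)
  moreover have "S' \<subseteq> ?V" using Suc.prems parents_stage_Suc unfolding S'_def by fast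
  ultimately obtain D where D: "finite D" "S' \<subseteq> D" "D \<subseteq> ?V" "\<forall>x\<in>D. parents x \<subseteq> D"
    using Suc.IH by meson
  have "?V \<subseteq> elements (free_stage P (Suc n))" by (rule elements_free_stage_mono) simp
  then have "D \<union> S \<subseteq> elements (free_stage P (Suc n))" using D Suc.prems by blast
  moreover have "\<forall>x\<in>D \<union> S. parents x \<subseteq> D \<union> S"
    using D unfolding S'_def by blast
  ultimately show ?case using D(1) Suc.prems(1) by (intro exI[of _ "D \<union> S"]) auto
qed

lemma finite_subset_stage:
  assumes "finite S" "S \<subseteq> elements (free_extension P)"
  shows "\<exists>n. S \<subseteq> elements (free_stage P n)"
  using assms
proof (induction rule: finite_induct)
  case empty
  then show ?case by simp
next
  case (insert x S)
  then obtain n k where "S \<subseteq> elements (free_stage P n)" "x \<in> elements (free_stage P k)"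
    by (auto simp: elements_free_extension)
  then have "insert x S \<subseteq> elements (free_stage P (max n k))"
    using elements_free_stage_mono[of n "max n k" P] elements_free_stage_mono[of k "max n k" P] by auto
  then show ?case ..
qed

text \<open>Beyond the initial incidences, new ones arise only between an added element and the pair
  generating it.\<close>

lemma incidence_free_stage_cases:
  assumes "(p, l) \<in> incidence (free_stage P n)"
  shows "Inr l \<in> parents (Inl p) \<or> Inl p \<in> parents (Inr l) \<or>
    (\<exists>q m. p = OldPoint q \<and> l = OldLine m \<and> (q, m) \<in> incidence P)"
  using assms
  by (induction n) (auto simp: old_part_def add_joins_def add_meets_def split: if_splits)

lemma adj_free_extension_cases:
  assumes "adj (free_extension P) x y"
  obtains "y \<in> parents x" | "x \<in> parents y"
    | q m where "x = Inl (OldPoint q)" "y = Inr (OldLine m)" "(q, m) \<in> incidence P"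
    | q m where "y = Inl (OldPoint q)" "x = Inr (OldLine m)" "(q, m) \<in> incidence P"
proof -
  obtain p l where pl: "(p, l) \<in> incidence (free_extension P)"
    "x = Inl p \<and> y = Inr l \<or> x = Inr l \<and> y = Inl p" using assms by (auto simp: adj_def)
  then obtain n where "(p, l) \<in> incidence (free_stage P n)" by (auto simp: incidence_free_extension)
  then show thesis using incidence_free_stage_cases[of p l P n] pl(2) that by blast
qed

section \<open>Strong sets and generic points in \<open>\<pi>\<^sup>\<omega>\<close>\<close>

section \<open>The plane \<open>\<pi>\<^sup>\<omega>\<close>\<close>

abbreviation "base_pt q \<equiv> (Inl (OldPoint q) :: (base_point, base_line) fpoint + (base_point, base_line) fline)"
abbreviation "base_ln \<equiv> (Inr (OldLine Ell) :: (base_point, base_line) fpoint + (base_point, base_line) fline)"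

lemma base_elements: "base_pt q \<in> elements pi_omega" "base_ln \<in> elements pi_omega"
proof -
  have "base_pt q \<in> elements (free_stage pi_omega_0 0)" "base_ln \<in> elements (free_stage pi_omega_0 0)"
    by (auto simp: elements_def old_part_def pi_omega_0_def)
  then show "base_pt q \<in> elements pi_omega" "base_ln \<in> elements pi_omega"
    unfolding pi_omega_def elements_free_extension by blast+
qed

lemma adj_base_pt:
  assumes "adj pi_omega (base_pt q) y"
  shows "base_pt q \<in> parents y \<or> y = base_ln \<and> (\<exists>n. q = On n)"
  using assms unfolding pi_omega_def
  by (cases rule: adj_free_extension_cases) (auto simp: pi_omega_0_def)

text \<open>A last-born \<open>e\<close> in \<open>E\<close> is a parent of nothing in
  \<open>D \<union> E\<close>: in \<open>E\<close> by maximality, in \<open>D\<close> by closure.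
  Its neighbours there are at most its two parents or, for a base point, at most \<open>Ell\<close>.
  Placing \<open>base_ln\<close> in \<open>D\<close> excludes \<open>Ell\<close> itself, whose base
  neighbours are neither parents nor children.\<close>

lemma parent_closed_strong:
  assumes D: "finite D" "D \<subseteq> elements pi_omega" "base_ln \<in> D" and par: "\<forall>x\<in>D. parents x \<subseteq> D"
  shows "strong pi_omega D"
  unfolding strong_def
proof (intro conjI allI impI)
  fix E assume E: "E \<subseteq> elements pi_omega - D" "finite E" "E \<noteq> {}"
  have "Max (birth pi_omega_0 ` E) \<in> birth pi_omega_0 ` E" using E by (intro Max_in) auto
  then obtain e where e: "e \<in> E" "birth pi_omega_0 e = Max (birth pi_omega_0 ` E)" by auto
  have max: "birth pi_omega_0 y \<le> birth pi_omega_0 e" if "y \<in> E" for y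
    using e E that by simp
  have nopar: "e \<notin> parents y" if "y \<in> D \<union> E" for y
  proof
    assume p: "e \<in> parents y"
    then have "y \<in> E" using that par e(1) E(1) by blast
    then have "birth pi_omega_0 e < birth pi_omega_0 y"
      using birth_parents[of y pi_omega_0 e] p E(1) by (auto simp: pi_omega_def)
    then show False using max[OF \<open>y \<in> E\<close>] by simp
  qed
  have "e \<noteq> base_ln" using e E D by blast
  have "card (nbrs pi_omega e (D \<union> E)) \<le> 2"
  proof (cases "\<exists>q. e = base_pt q")
    case True
    then have "nbrs pi_omega e (D \<union> E) \<subseteq> {base_ln}" using adj_base_pt nopar by fastforce
    then have "card (nbrs pi_omega e (D \<union> E)) \<le> card {base_ln}" by (rule card_mono[rotated]) simp
    then show ?thesis by simp
  next
    case False
    have "nbrs pi_omega e (D \<union> E) \<subseteq> parents e"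
    proof
      fix y assume y: "y \<in> nbrs pi_omega e (D \<union> E)"
      then have "adj (free_extension pi_omega_0) e y" by (simp add: pi_omega_def)
      then show "y \<in> parents e"
        by (cases rule: adj_free_extension_cases)
          (use y nopar False \<open>e \<noteq> base_ln\<close> in \<open>auto simp: pi_omega_0_def\<close>)
    qed
    then have "card (nbrs pi_omega e (D \<union> E)) \<le> card (parents e)"
      by (rule card_mono[OF finite_parents])
    then show ?thesis using card_parents[of e] by simp
  qed
  then show "\<exists>e\<in>E. card (nbrs pi_omega e (D \<union> E)) \<le> 2" using e(1) by blast
qed (use D in simp)

lemma parent_closed_superset_pi_omega:
  assumes "finite S" "S \<subseteq> elements pi_omega"
  shows "\<exists>D. finite D \<and> S \<subseteq> D \<and> D \<subseteq> elements pi_omega \<and> (\<forall>x\<in>D. parents x \<subseteq> D)"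
proof -
  obtain n where "S \<subseteq> elements (free_stage pi_omega_0 n)"
    using finite_subset_stage assms unfolding pi_omega_def by blast
  then obtain D where "finite D" "S \<subseteq> D" "D \<subseteq> elements (free_stage pi_omega_0 n)"
    "\<forall>x\<in>D. parents x \<subseteq> D"
    using parent_closed_superset[OF assms(1)] by meson
  then show ?thesis unfolding pi_omega_def elements_free_extension by blast
qed

lemma common_nbr_pi_omega:
  assumes "x \<in> elements pi_omega" "y \<in> elements pi_omega" "x \<noteq> y" "isl x = isl y"
  shows "\<exists>z\<in>elements pi_omega. adj pi_omega z x \<and> adj pi_omega z y"
proof -
  obtain z where z: "adj pi_omega x z" "adj pi_omega y z"
    using common_nbr_free_extension[of x pi_omega_0 y] assms unfolding pi_omega_def by blast
  moreover have "z \<in> elements pi_omega"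
    using z(1) incidence_free_extension_subset[OF partial_plane_pi_omega_0]
    by (auto simp: adj_def pi_omega_def)
  ultimately show ?thesis using adj_sym by blast
qed

text \<open>The generic point is the intersection of the lines joining \<open>Off1\<close> and \<open>Off2\<close> to two points
  of \<open>Ell\<close> that \<open>D\<close> does not depend on: starting from it, those two lines and then the two points
  of \<open>Ell\<close> can conversely be recovered as a join or a meet.\<close>

lemma generic_point_pi_omega:
  assumes D: "finite D" "strong pi_omega D"
  shows "\<exists>x\<in>elements pi_omega - D. isl x \<and> nbrs pi_omega x D = {} \<and> strong pi_omega (insert x D)"
proof -
  let ?o1 = "base_pt Off1" and ?o2 = "base_pt Off2"
  have "finite (D \<union> {?o1, ?o2, base_ln})" "D \<union> {?o1, ?o2, base_ln} \<subseteq> elements pi_omega"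
    using D strong_subset[OF D(2)] base_elements by auto
  then obtain D1 where D1: "finite D1" "D \<union> {?o1, ?o2, base_ln} \<subseteq> D1" "D1 \<subseteq> elements pi_omega"
    and par: "\<forall>x\<in>D1. parents x \<subseteq> D1"
    using parent_closed_superset_pi_omega by meson
  have "finite ((\<lambda>n. base_pt (On n)) -` D1)"
    using D1(1) by (rule finite_vimageI) (auto simp: inj_def)
  then obtain N where "\<forall>n\<in>(\<lambda>n. base_pt (On n)) -` D1. n < N"
    unfolding finite_nat_set_iff_bounded ..
  then have N: "n < N" if "base_pt (On n) \<in> D1" for n using that by simp
  \<comment> \<open>\<open>N\<close> exceeds the index of every \<open>On\<close> point in
    \<open>D1\<close>, so \<open>a\<close> and \<open>b\<close> are new. They have no parents, hence
    \<open>D2\<close> below stays closed under parents.\<close>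
  define a where "a = base_pt (On N)"
  define b where "b = base_pt (On (Suc N))"
  have aD1: "a \<notin> D1" and bD1: "b \<notin> D1" using N[of N] N[of "Suc N"] by (auto simp: a_def b_def)
  have ab: "a \<noteq> b" "a \<noteq> ?o1" "a \<noteq> ?o2" "b \<noteq> ?o1" "b \<noteq> ?o2" by (auto simp: a_def b_def)
  have isl_ab: "isl a" "isl b" by (auto simp: a_def b_def)
  have abV: "a \<in> elements pi_omega" "b \<in> elements pi_omega" using base_elements by (auto simp: a_def b_def)
  have o: "?o1 \<in> D1" "?o2 \<in> D1" using D1(2) by auto
  define D2 where "D2 = insert b (insert a D1)"
  have D2: "finite D2" "D2 \<subseteq> elements pi_omega" using D1 abV by (auto simp: D2_def)
  have s2: "strong pi_omega D2"
    by (rule parent_closed_strong[OF D2]) (use D1(2) par in \<open>auto simp: D2_def a_def b_def\<close>)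
  have na: "y = base_ln" if "y \<in> D1" "adj pi_omega a y" for y
    using adj_base_pt[of "On N" y] that par aD1 by (auto simp: a_def)
  have nb: "y = base_ln" if "y \<in> D1" "adj pi_omega b y" for y
    using adj_base_pt[of "On (Suc N)" y] that par bD1 by (auto simp: b_def)
  have off: "\<not> adj pi_omega base_ln ?o1" "\<not> adj pi_omega base_ln ?o2"
    using adj_base_pt[of Off1 base_ln] adj_base_pt[of Off2 base_ln] by (auto dest: adj_sym)
  obtain m where m: "m \<in> elements pi_omega" "adj pi_omega m a" "adj pi_omega m ?o1"
    using common_nbr_pi_omega[of a ?o1] abV base_elements ab isl_ab by auto
  obtain k where k: "k \<in> elements pi_omega" "adj pi_omega k b" "adj pi_omega k ?o2"
    using common_nbr_pi_omega[of b ?o2] abV base_elements ab isl_ab by auto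
  have isl_mk: "\<not> isl m" "\<not> isl k" using m k isl_ab adj_isl by blast+
  \<comment> \<open>A line of \<open>D1\<close> through \<open>a\<close> can only be
    \<open>Ell\<close>, which misses \<open>Off1\<close>; similarly for \<open>k\<close> with
    \<open>b\<close> and \<open>Off2\<close>.\<close>
  have mD2: "m \<notin> D2" using na[of m] m off isl_mk isl_ab adj_sym by (auto simp: D2_def)
  have kD2: "k \<notin> D2" using nb[of k] k off isl_mk isl_ab adj_sym by (auto simp: D2_def)
  have nm: "nbrs pi_omega m D2 = {a, ?o1}"
    by (rule nbrs_eq_pair) (use s2 D2 m mD2 o ab in \<open>auto simp: D2_def\<close>)
  have nk: "nbrs pi_omega k D2 = {b, ?o2}"
    by (rule nbrs_eq_pair) (use s2 D2 k kD2 o ab in \<open>auto simp: D2_def\<close>)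
  have "m \<noteq> k" using nm nk ab by auto
  have s3: "strong pi_omega (insert m D2)"
    by (rule strong_insert) (use s2 D2 m mD2 nm ab in auto)
  have nk3: "nbrs pi_omega k (insert m D2) = {b, ?o2}"
    by (rule nbrs_eq_pair) (use s3 D2 k kD2 o ab \<open>m \<noteq> k\<close> in \<open>auto simp: D2_def\<close>)
  define D4 where "D4 = insert k (insert m D2)"
  have s4: "strong pi_omega D4" unfolding D4_def
    by (rule strong_insert) (use s3 D2 k kD2 nk3 ab \<open>m \<noteq> k\<close> in auto)
  have D4: "finite D4" using D2 by (simp add: D4_def)
  obtain x where x: "x \<in> elements pi_omega" "adj pi_omega x m" "adj pi_omega x k"
    using common_nbr_pi_omega[of m k] m(1) k(1) \<open>m \<noteq> k\<close> isl_mk by auto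
  have isl_x: "isl x" using x isl_mk adj_isl by blast
  have "x \<notin> D2"
  proof
    assume "x \<in> D2"
    then have "x \<in> nbrs pi_omega m D2" "x \<in> nbrs pi_omega k D2" using x adj_sym by auto
    then show False using nm nk ab by auto
  qed
  then have xD4: "x \<notin> D4" using isl_x isl_mk by (auto simp: D4_def)
  have nx: "nbrs pi_omega x D4 = {m, k}"
    by (rule nbrs_eq_pair) (use s4 D4 x xD4 \<open>m \<noteq> k\<close> in \<open>auto simp: D4_def\<close>)
  have s5: "strong pi_omega (insert x D4)"
    by (rule strong_insert) (use s4 D4 x xD4 nx \<open>m \<noteq> k\<close> in auto)
  have adj_m: "y = ?o1" if "y \<in> D1" "adj pi_omega m y" for y
    using that nm aD1 in_nbrs[of y pi_omega m D2] by (auto simp: D2_def)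
  have adj_k: "y = ?o2" if "y \<in> D1" "adj pi_omega k y" for y
    using that nk bD1 in_nbrs[of y pi_omega k D2] by (auto simp: D2_def)
  have not_adj: "\<not> adj pi_omega a k" "\<not> adj pi_omega b m"
    using nm nk ab in_nbrs[of b pi_omega m D2] in_nbrs[of a pi_omega k D2] adj_sym[of pi_omega]
    by (auto simp: D2_def)
  have pts: "\<not> adj pi_omega u v" if "isl u = isl v" for u v using that adj_isl by blast
  have two: "card Z \<le> 2" if "Z \<subseteq> {u, v}" for Z and u v :: "(base_point, base_line) fpoint + (base_point, base_line) fline"
  proof -
    have "card Z \<le> card {u, v}" using that by (rule card_mono[rotated]) simp
    then show ?thesis using card_insert_le_m1[of 2 "{v}" u] by simp
  qed
  \<comment> \<open>By \<open>strong_sub\<close> only sets \<open>E\<close> of the auxiliary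
    elements \<open>a\<close>, \<open>b\<close>, \<open>m\<close>, \<open>k\<close> matter. Here
    \<open>a\<close> sees at most \<open>Ell\<close> and \<open>m\<close>, and \<open>b\<close> at
    most \<open>Ell\<close> and \<open>k\<close>; if both are absent, \<open>m\<close> sees at most
    \<open>Off1\<close> and \<open>x\<close>, and \<open>k\<close> at most \<open>Off2\<close> and
    \<open>x\<close>.\<close>
  have sx: "strong pi_omega (insert x D1)"
  proof (rule strong_sub[OF s5])
    show "finite (insert x D4)" using D4 by simp
    show "insert x D1 \<subseteq> insert x D4" by (auto simp: D4_def D2_def)
  next
    fix E assume E: "E \<subseteq> insert x D4 - insert x D1" "E \<noteq> {}"
    then have E4: "E \<subseteq> {a, b, m, k}" by (auto simp: D4_def D2_def)
    let ?n = "\<lambda>e. nbrs pi_omega e (insert x D1 \<union> E)"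
    consider "a \<in> E" | "b \<in> E" | "E \<subseteq> {m, k}" using E4 by blast
    then show "\<exists>e\<in>E. card (?n e) \<le> 2"
    proof cases
      case 1
      have "?n a \<subseteq> nbrs pi_omega a (insert x D1 \<union> {a, b, m, k})"
        by (rule nbrs_mono) (use E4 in blast)
      also have "\<dots> \<subseteq> {base_ln, m}"
        using na not_adj pts isl_ab isl_x by auto
      finally have "?n a \<subseteq> {base_ln, m}" .
      then show ?thesis using 1 two by blast
    next
      case 2
      have "?n b \<subseteq> nbrs pi_omega b (insert x D1 \<union> {a, b, m, k})"
        by (rule nbrs_mono) (use E4 in blast)
      also have "\<dots> \<subseteq> {base_ln, k}"
        using nb not_adj pts isl_ab isl_x by auto
      finally have "?n b \<subseteq> {base_ln, k}" .
      then show ?thesis using 2 two by blast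
    next
      case 3
      have "nbrs pi_omega m (insert x D1 \<union> {m, k}) \<subseteq> {?o1, x}"
          "nbrs pi_omega k (insert x D1 \<union> {m, k}) \<subseteq> {?o2, x}"
        using adj_m adj_k pts isl_mk by auto
      moreover have "?n e \<subseteq> nbrs pi_omega e (insert x D1 \<union> {m, k})" for e
        by (rule nbrs_mono) (use 3 in blast)
      ultimately have "?n m \<subseteq> {?o1, x}" "?n k \<subseteq> {?o2, x}" by (meson subset_trans)+
      moreover have "m \<in> E \<or> k \<in> E" using 3 E(2) by blast
      ultimately show ?thesis using two by blast
    qed
  qed
  have nxD1: "\<not> adj pi_omega x y" if "y \<in> D1" for y
    using that nx mD2 kD2 in_nbrs[of y pi_omega x D4] by (auto simp: D4_def D2_def)
  have xD1: "x \<notin> D1" using xD4 by (auto simp: D4_def D2_def)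
  \<comment> \<open>Descent from \<open>D1\<close> to \<open>D\<close>: if \<open>E\<close> leaves
    \<open>D1\<close>, strength of \<open>insert x D1\<close> handles the part outside; if
    \<open>E\<close> stays in \<open>D1\<close>, then \<open>x\<close> has no neighbour in
    \<open>E\<close> and strength of \<open>D\<close> suffices.\<close>
  have "strong pi_omega (insert x D)"
    unfolding strong_def
  proof (intro conjI allI impI)
    show "insert x D \<subseteq> elements pi_omega" using x strong_subset[OF D(2)] by auto
  next
    fix E assume E: "E \<subseteq> elements pi_omega - insert x D" "finite E" "E \<noteq> {}"
    show "\<exists>e\<in>E. card (nbrs pi_omega e (insert x D \<union> E)) \<le> 2"
    proof (cases "E \<subseteq> D1")
      case False
      then have "\<exists>e\<in>E - D1. card (nbrs pi_omega e (insert x D1 \<union> (E - D1))) \<le> 2"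
        by (intro strongD[OF sx]) (use E in auto)
      then obtain e where e: "e \<in> E - D1" "card (nbrs pi_omega e (insert x D1 \<union> (E - D1))) \<le> 2" ..
      have "card (nbrs pi_omega e (insert x D \<union> E)) \<le> card (nbrs pi_omega e (insert x D1 \<union> (E - D1)))"
        by (rule card_nbrs_mono) (use D1 E in auto)
      then show ?thesis using e by (intro bexI[of _ e]) auto
    next
      case True
      have "\<exists>e\<in>E. card (nbrs pi_omega e (D \<union> E)) \<le> 2"
        by (intro strongD[OF D(2)]) (use E in auto)
      then obtain e where e: "e \<in> E" "card (nbrs pi_omega e (D \<union> E)) \<le> 2" ..
      have "\<not> adj pi_omega e x" using nxD1 True e(1) adj_sym by blast
      then have "nbrs pi_omega e (insert x D \<union> E) = nbrs pi_omega e (D \<union> E)" by auto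
      then have "card (nbrs pi_omega e (insert x D \<union> E)) \<le> 2" using e(2) by simp
      then show ?thesis using e(1) ..
    qed
  qed
  moreover have "nbrs pi_omega x D = {}" using nxD1 D1(2) by auto
  ultimately show ?thesis using x(1) xD1 D1(2) isl_x by (intro bexI[of _ x]) auto
qed

interpretation pi_omega: generic_plane pi_omega
proof
  show "incidence pi_omega \<subseteq> points pi_omega \<times> lines pi_omega"
    unfolding pi_omega_def by (rule incidence_free_extension_subset[OF partial_plane_pi_omega_0])
  show "\<exists>z. adj pi_omega x z \<and> adj pi_omega y z"
    if "x \<in> elements pi_omega" "y \<in> elements pi_omega" "x \<noteq> y" "isl x \<longleftrightarrow> isl y" for x y
    using common_nbr_pi_omega[OF that] adj_sym by blast
  show "z = w" if "x \<noteq> y" "adj pi_omega x z" "adj pi_omega y z" "adj pi_omega x w" "adj pi_omega y w"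
    for x y z w
    using common_nbr_unique_free_extension[OF partial_plane_pi_omega_0 that[unfolded pi_omega_def]] .
  have "UNIV = range On \<union> {Off1, Off2}" using base_point.exhaust by blast
  then have "countable (UNIV :: base_point set)" by (metis countable_Un countable_image countable_finite
        countableI_type finite.emptyI finite.insertI)
  then show "countable (elements pi_omega)"
    unfolding pi_omega_def by (intro countable_free_extension) (auto simp: pi_omega_0_def)
  show "\<exists>D. finite D \<and> S \<subseteq> D \<and> strong pi_omega D" if "finite S" "S \<subseteq> elements pi_omega" for S
  proof -
    \<comment> \<open>\<open>base_ln\<close> is put in because \<open>parent_closed_strong\<close>
      asks for it.\<close>
    have "finite (insert base_ln S)" "insert base_ln S \<subseteq> elements pi_omega"
      using that base_elements by auto
    then obtain D where "finite D" "insert base_ln S \<subseteq> D" "D \<subseteq> elements pi_omega"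
        "\<forall>x\<in>D. parents x \<subseteq> D"
      using parent_closed_superset_pi_omega by meson
    then show ?thesis using parent_closed_strong[of D] by auto
  qed
qed (rule generic_point_pi_omega)

theorem theorem1p8:
  fixes a b :: "((base_point, base_line) fpoint + (base_point, base_line) fline) list"
    and A :: "((base_point, base_line) fpoint + (base_point, base_line) fline) set"
  assumes "set a \<subseteq> elements pi_omega"
    and "set b \<subseteq> elements pi_omega"
    and "A \<subseteq> elements pi_omega"
    and "finite A"
  shows "type_over pi_omega A a = type_over pi_omega A b \<longleftrightarrow>
    (\<exists>f g. automorphism pi_omega f g \<and>
      (\<forall>x\<in>A. map_sum f g x = x) \<and> map (map_sum f g) a = b)"
  using assms by (rule pi_omega.strongly_type_homogeneous)

end
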